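(* Let $G$ be a strongly topological gyrogroup and let $H$ be a closed strong subgyrogroup of $G$ which is inner neutral. Then the following are equivalent: (1) $G/H$ is first-countable; (2) $G/H$ is a bisequential space; (3) $G/H$ is a weakly first-countable space; (4) $G/H$ is a $csf$-countable and sequential $\alpha_7$-space.
   Context: All topological spaces are assumed Hausdorff. A gyrogroup is a nonempty set $G$ with a binary operation $\oplus$ such that: (G1) there is a unique $0\in G$ with $0\oplus a=a=a\oplus 0$ for all $a$; (G2) each $x\in G$ has a unique inverse $\ominus x$ with $\ominus x\oplus x=0=x\oplus(\ominus x)$; (G3) for all $x,y\in G$ there is an automorphism $\mathrm{gyr}[x,y]$ of $(G,\oplus)$ with $x\oplus(y\oplus z)=(x\oplus y)\oplus\mathrm{gyr}[x,y](z)$ for all $z\in G$; (G4) $\mathrm{gyr}[x\oplus y,y]=\mathrm{gyr}[x,y]$ for all $x,y\in G$. A topological gyrogroup is a gyrogroup with a topology making $\oplus:G\times G\to G$ jointly continuous and $x\mapsto\ominus x$ continuous. It is a strongly topological gyrogroup if there is a neighborhood base $\mathscr U$ of $0$ with $\mathrm{gyr}[x,y](U)=U$ for all $U\in\mathscr U$ and $x,y\in G$. A subgyrogroup is a nonempty subset $H\subseteq G$ that is a gyrogroup under the inherited operation and such that $\mathrm{gyr}[a,b]$ restricts to an automorphism of $H$ for all $a,b\in H$. It is a strong subgyrogroup if $\mathrm{gyr}[x,y](H)=H$ for all $x,y\in G$. For such $H$ the left cosets $a\oplus H$ ($a\in G$) partition $G$; $G/H=\{a\oplus H:a\in G\}$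 carries the quotient topology induced by $\pi:G\to G/H$, $\pi(a)=a\oplus H$. $H$ is inner neutral if for every open neighborhood $U$ of $0$ in $G$ there is an open neighborhood $V$ of $0$ with $H\oplus V\subseteq U\oplus H$, where $A\oplus B=\{a\oplus b:a\in A,b\in B\}$. Let $X$ be a topological space. Bisequential: a prefilter on $X$ is a nonempty family $\zeta$ of non-empty subsets of $X$ such that for all $P_1,P_2\in\zeta$ there is $P\in\zeta$ with $P\subseteq P_1\cap P_2$. It converges to $x$ if every open neighborhood of $x$ contains an element of $\zeta$; it accumulates to $x$ if $x\in\overline P$ for every $P\in\zeta$. Prefilters $\zeta,\eta$ are synchronous if $P\cap Q\ne\emptyset$ for all $P\in\zeta$, $Q\in\eta$. $X$ is bisequential if for every prefilter $\zeta$ on $X$ accumulating to a point $x$ there is a countable prefilter $\eta$ converging to $x$ such that $\zeta$ and $\eta$ are synchronous. Weakly first-countable: to each $x\in X$ one can assign a sequence $\{B(n,x):n\in\mathbb N\}$ of subsets of $X$ containing $x$ with $B(n+1,x)\subseteq B(n,x)$, such that a set $U\subseteq X$ is open if and only if for each $x\in U$ there is $n$ with $B(n,x)\subseteq U$. $csf$-countable: for each $x\in X$ there is a countable $cs$-network at $x$, i.e. a countable family $\mathscr P$ of subsets of $X$ with $x\in\bigcap\mathscr P$ such that for every sequence $L$ converging to $x$ and every neighborhood $U$ of $x$ there is $P\in\mathscr P$ with $P\subseteq U$ and $L$ eventually in $P$. Sequential: for each non-closed $A\subseteq X$ there are $x\in X\setminus A$ and a sequence in $A$ converging to $x$. $\alpha_7$-space: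 for every $x\in X$ and each sheaf $\{S_n:n\in\omega\}$ with vertex $x$ (a countable family of sequences in $X\setminus\{x\}$, each converging to $x$) there is a sequence converging to some point $y\in X$ which meets $S_n$ for infinitely many $n$. *)

theory Defs
  imports "HOL-Analysis.Analysis"
begin

section \<open>Gyrogroups\<close>

text \<open>
  A gyrogroup is given by a carrier \<open>G\<close> together with its operation, neutral element, inversion and
  gyrations. The last three are determined on \<open>G\<close> by the operation; none of the conditions below
  refers to values outside of \<open>G\<close>.
\<close>

definition gyro_automorphism :: "'a set \<Rightarrow> ('a \<Rightarrow> 'a \<Rightarrow> 'a) \<Rightarrow> ('a \<Rightarrow> 'a) \<Rightarrow> bool" where
  "gyro_automorphism G add f \<longleftrightarrow>
     bij_betw f G G \<and> (\<forall>x\<in>G. \<forall>y\<in>G. f (add x y) = add (f x) (f y))"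

locale gyrogroup =
  fixes G :: "'a set"
    and add :: "'a \<Rightarrow> 'a \<Rightarrow> 'a"
    and zero :: 'a
    and neg :: "'a \<Rightarrow> 'a"
    and gyr :: "'a \<Rightarrow> 'a \<Rightarrow> 'a \<Rightarrow> 'a"
  assumes add_closed: "\<And>x y. x \<in> G \<Longrightarrow> y \<in> G \<Longrightarrow> add x y \<in> G"
    and zero_closed: "zero \<in> G"
    and zero_neutral: "\<And>a. a \<in> G \<Longrightarrow> add zero a = a \<and> add a zero = a"
    and zero_unique: "\<And>e. e \<in> G \<Longrightarrow> (\<forall>a\<in>G. add e a = a \<and> add a e = a) \<Longrightarrow> e = zero"
    and neg_closed: "\<And>x. x \<in> G \<Longrightarrow> neg x \<in> G"
    and neg_inverse: "\<And>x. x \<in> G \<Longrightarrow> add (neg x) x = zero \<and> add x (neg x) = zero"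
    and neg_unique: "\<And>x y. x \<in> G \<Longrightarrow> y \<in> G \<Longrightarrow> add y x = zero \<Longrightarrow> add x y = zero \<Longrightarrow> y = neg x"
    and gyr_automorphism: "\<And>x y. x \<in> G \<Longrightarrow> y \<in> G \<Longrightarrow> gyro_automorphism G add (gyr x y)"
    and gyr_assoc: "\<And>x y z. x \<in> G \<Longrightarrow> y \<in> G \<Longrightarrow> z \<in> G \<Longrightarrow>
          add x (add y z) = add (add x y) (gyr x y z)"
    and gyr_loop: "\<And>x y z. x \<in> G \<Longrightarrow> y \<in> G \<Longrightarrow> z \<in> G \<Longrightarrow> gyr (add x y) y z = gyr x y z"

definition subgyrogroup ::
  "'a set \<Rightarrow> ('a \<Rightarrow> 'a \<Rightarrow> 'a) \<Rightarrow> ('a \<Rightarrow> 'a \<Rightarrow> 'a \<Rightarrow> 'a) \<Rightarrow> 'a set \<Rightarrow> bool" where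
  "subgyrogroup G add gyr H \<longleftrightarrow>
     H \<noteq> {} \<and> H \<subseteq> G \<and>
     (\<exists>zero' neg' gyr'. gyrogroup H add zero' neg' gyr') \<and>
     (\<forall>a\<in>H. \<forall>b\<in>H. gyro_automorphism H add (gyr a b))"

definition strong_subgyrogroup ::
  "'a set \<Rightarrow> ('a \<Rightarrow> 'a \<Rightarrow> 'a) \<Rightarrow> ('a \<Rightarrow> 'a \<Rightarrow> 'a \<Rightarrow> 'a) \<Rightarrow> 'a set \<Rightarrow> bool" where
  "strong_subgyrogroup G add gyr H \<longleftrightarrow>
     subgyrogroup G add gyr H \<and> (\<forall>x\<in>G. \<forall>y\<in>G. gyr x y ` H = H)"

definition set_add :: "('a \<Rightarrow> 'a \<Rightarrow> 'a) \<Rightarrow> 'a set \<Rightarrow> 'a set \<Rightarrow> 'a set" where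
  "set_add add A B = {add a b | a b. a \<in> A \<and> b \<in> B}"

definition left_coset :: "('a \<Rightarrow> 'a \<Rightarrow> 'a) \<Rightarrow> 'a set \<Rightarrow> 'a \<Rightarrow> 'a set" where
  "left_coset add H a = set_add add {a} H"


section \<open>Topological gyrogroups\<close>

definition neighborhood_in :: "'a topology \<Rightarrow> 'a \<Rightarrow> 'a set \<Rightarrow> bool" where
  "neighborhood_in X x U \<longleftrightarrow> U \<subseteq> topspace X \<and> (\<exists>W. openin X W \<and> x \<in> W \<and> W \<subseteq> U)"

text \<open>The carrier of a topological gyrogroup is the underlying set of its topology.\<close>

locale topological_gyrogroup = gyrogroup "topspace T" add zero neg gyr
  for T :: "'a topology"
    and add :: "'a \<Rightarrow> 'a \<Rightarrow> 'a"
    and zero :: 'a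
    and neg :: "'a \<Rightarrow> 'a"
    and gyr :: "'a \<Rightarrow> 'a \<Rightarrow> 'a \<Rightarrow> 'a" +
  assumes hausdorff: "Hausdorff_space T"
    and continuous_add: "continuous_map (prod_topology T T) T (\<lambda>(x, y). add x y)"
    and continuous_neg: "continuous_map T T neg"

locale strongly_topological_gyrogroup = topological_gyrogroup T add zero neg gyr
  for T :: "'a topology"
    and add :: "'a \<Rightarrow> 'a \<Rightarrow> 'a"
    and zero :: 'a
    and neg :: "'a \<Rightarrow> 'a"
    and gyr :: "'a \<Rightarrow> 'a \<Rightarrow> 'a \<Rightarrow> 'a" +
  assumes invariant_base:
    "\<exists>\<U>. (\<forall>U\<in>\<U>. neighborhood_in T zero U) \<and>
          (\<forall>W. neighborhood_in T zero W \<longrightarrow> (\<exists>U\<in>\<U>. U \<subseteq> W)) \<and>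
          (\<forall>U\<in>\<U>. \<forall>x\<in>topspace T. \<forall>y\<in>topspace T. gyr x y ` U = U)"

definition inner_neutral :: "'a topology \<Rightarrow> ('a \<Rightarrow> 'a \<Rightarrow> 'a) \<Rightarrow> 'a \<Rightarrow> 'a set \<Rightarrow> bool" where
  "inner_neutral T add zero H \<longleftrightarrow>
     (\<forall>U. openin T U \<and> zero \<in> U \<longrightarrow>
        (\<exists>V. openin T V \<and> zero \<in> V \<and> set_add add H V \<subseteq> set_add add U H))"

definition coset_space :: "'a topology \<Rightarrow> ('a \<Rightarrow> 'a \<Rightarrow> 'a) \<Rightarrow> 'a set \<Rightarrow> 'a set topology" where
  "coset_space T add H =
     topology (\<lambda>\<V>. \<V> \<subseteq> left_coset add H ` topspace T \<and>
                    openin T {a \<in> topspace T. left_coset add H a \<in> \<V>})"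

lemma openin_coset_space:
  "openin (coset_space T add H) \<V> \<longleftrightarrow>
     \<V> \<subseteq> left_coset add H ` topspace T \<and> openin T {a \<in> topspace T. left_coset add H a \<in> \<V>}"
proof -
  let ?p = "left_coset add H"
  have "istopology (\<lambda>\<V>. \<V> \<subseteq> ?p ` topspace T \<and> openin T {a \<in> topspace T. ?p a \<in> \<V>})"
    unfolding istopology_def
  proof (intro conjI allI impI)
    fix S S'
    assume S: "S \<subseteq> ?p ` topspace T \<and> openin T {a \<in> topspace T. ?p a \<in> S}"
      and S': "S' \<subseteq> ?p ` topspace T \<and> openin T {a \<in> topspace T. ?p a \<in> S'}"
    show "S \<inter> S' \<subseteq> ?p ` topspace T" using S by blast
    have "{a \<in> topspace T. ?p a \<in> S \<inter> S'} =
          {a \<in> topspace T. ?p a \<in> S} \<inter> {a \<in> topspace T. ?p a \<in> S'}" by blast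
    then show "openin T {a \<in> topspace T. ?p a \<in> S \<inter> S'}" using S S' by (simp add: openin_Int)
  next
    fix \<K>
    assume K: "\<forall>K\<in>\<K>. K \<subseteq> ?p ` topspace T \<and> openin T {a \<in> topspace T. ?p a \<in> K}"
    show "\<Union>\<K> \<subseteq> ?p ` topspace T" using K by blast
    have "{a \<in> topspace T. ?p a \<in> \<Union>\<K>} = (\<Union>K\<in>\<K>. {a \<in> topspace T. ?p a \<in> K})" by blast
    then show "openin T {a \<in> topspace T. ?p a \<in> \<Union>\<K>}" using K by auto
  qed
  then show ?thesis by (simp add: coset_space_def)
qed

lemma topspace_coset_space: "topspace (coset_space T add H) = left_coset add H ` topspace T"
proof
  show "topspace (coset_space T add H) \<subseteq> left_coset add H ` topspace T"
    using openin_coset_space openin_topspace by blast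
  have "{a \<in> topspace T. left_coset add H a \<in> left_coset add H ` topspace T} = topspace T" by blast
  then have "openin (coset_space T add H) (left_coset add H ` topspace T)"
    by (simp add: openin_coset_space)
  then show "left_coset add H ` topspace T \<subseteq> topspace (coset_space T add H)"
    by (rule openin_subset)
qed

lemma quotient_map_left_coset: "quotient_map T (coset_space T add H) (left_coset add H)"
  by (simp add: quotient_map_def topspace_coset_space openin_coset_space)


section \<open>Generalized countability properties\<close>

definition prefilter_on :: "'a topology \<Rightarrow> 'a set set \<Rightarrow> bool" where
  "prefilter_on X \<zeta> \<longleftrightarrow>
     \<zeta> \<noteq> {} \<and> (\<forall>P\<in>\<zeta>. P \<noteq> {} \<and> P \<subseteq> topspace X) \<and>
     (\<forall>P1\<in>\<zeta>. \<forall>P2\<in>\<zeta>. \<exists>P\<in>\<zeta>. P \<subseteq> P1 \<inter> P2)"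

definition prefilter_converges :: "'a topology \<Rightarrow> 'a set set \<Rightarrow> 'a \<Rightarrow> bool" where
  "prefilter_converges X \<zeta> x \<longleftrightarrow> (\<forall>U. openin X U \<and> x \<in> U \<longrightarrow> (\<exists>P\<in>\<zeta>. P \<subseteq> U))"

definition prefilter_accumulates :: "'a topology \<Rightarrow> 'a set set \<Rightarrow> 'a \<Rightarrow> bool" where
  "prefilter_accumulates X \<zeta> x \<longleftrightarrow> (\<forall>P\<in>\<zeta>. x \<in> X closure_of P)"

definition synchronous :: "'a set set \<Rightarrow> 'a set set \<Rightarrow> bool" where
  "synchronous \<zeta> \<eta> \<longleftrightarrow> (\<forall>P\<in>\<zeta>. \<forall>Q\<in>\<eta>. P \<inter> Q \<noteq> {})"

definition bisequential :: "'a topology \<Rightarrow> bool" where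
  "bisequential X \<longleftrightarrow>
     (\<forall>\<zeta>. \<forall>x\<in>topspace X. prefilter_on X \<zeta> \<and> prefilter_accumulates X \<zeta> x \<longrightarrow>
        (\<exists>\<eta>. prefilter_on X \<eta> \<and> countable \<eta> \<and> prefilter_converges X \<eta> x \<and> synchronous \<zeta> \<eta>))"

definition weakly_first_countable :: "'a topology \<Rightarrow> bool" where
  "weakly_first_countable X \<longleftrightarrow>
     (\<exists>B :: nat \<Rightarrow> 'a \<Rightarrow> 'a set.
        (\<forall>x\<in>topspace X. \<forall>n. x \<in> B n x \<and> B n x \<subseteq> topspace X \<and> B (Suc n) x \<subseteq> B n x) \<and>
        (\<forall>U. U \<subseteq> topspace X \<longrightarrow> (openin X U \<longleftrightarrow> (\<forall>x\<in>U. \<exists>n. B n x \<subseteq> U))))"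

text \<open>
  Since \<^const>\<open>limitin\<close> allows finitely many terms outside of the space, the terms of a sequence
  in a space (or subset) are constrained explicitly.
\<close>

definition converging_sequence :: "'a topology \<Rightarrow> 'a set \<Rightarrow> (nat \<Rightarrow> 'a) \<Rightarrow> 'a \<Rightarrow> bool" where
  "converging_sequence X A s x \<longleftrightarrow>
     A \<subseteq> topspace X \<and> range s \<subseteq> A \<and> limitin X s x sequentially"

definition cs_network_at :: "'a topology \<Rightarrow> 'a \<Rightarrow> 'a set set \<Rightarrow> bool" where
  "cs_network_at X x \<P> \<longleftrightarrow>
     (\<forall>P\<in>\<P>. P \<subseteq> topspace X \<and> x \<in> P) \<and>
     (\<forall>L U. converging_sequence X (topspace X) L x \<and> neighborhood_in X x U \<longrightarrow>
        (\<exists>P\<in>\<P>. P \<subseteq> U \<and> (\<forall>\<^sub>F n in sequentially. L n \<in> P)))"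

definition csf_countable :: "'a topology \<Rightarrow> bool" where
  "csf_countable X \<longleftrightarrow> (\<forall>x\<in>topspace X. \<exists>\<P>. countable \<P> \<and> cs_network_at X x \<P>)"

definition sequential_space :: "'a topology \<Rightarrow> bool" where
  "sequential_space X \<longleftrightarrow>
     (\<forall>A. A \<subseteq> topspace X \<and> \<not> closedin X A \<longrightarrow>
        (\<exists>x\<in>topspace X - A. \<exists>s. converging_sequence X A s x))"

definition sheaf_with_vertex :: "'a topology \<Rightarrow> 'a \<Rightarrow> (nat \<Rightarrow> nat \<Rightarrow> 'a) \<Rightarrow> bool" where
  "sheaf_with_vertex X x S \<longleftrightarrow> (\<forall>n. converging_sequence X (topspace X - {x}) (S n) x)"

definition alpha7_space :: "'a topology \<Rightarrow> bool" where
  "alpha7_space X \<longleftrightarrow>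
     (\<forall>x\<in>topspace X. \<forall>S. sheaf_with_vertex X x S \<longrightarrow>
        (\<exists>L. \<exists>y\<in>topspace X. converging_sequence X (topspace X) L y \<and>
           infinite {n. range L \<inter> range (S n) \<noteq> {}}))"

end

theory Submission
  imports Defs
begin

text \<open>
  Inner neutrality makes the left translates of the images of small gyration-invariant neighborhoods
  of \<open>0\<close> a uniformity on \<open>G/H\<close> that is compatible with the topology and invariant under the transitive
  action of \<open>G\<close> by left translations. The equivalences hold in every \<open>T\<^sub>1\<close> space with such a homogeneous
  uniformity. For a bisequential space, the dense open sets yield a countable family of somewhere
  dense sets shrinking to a point, and translating the interiors of their closures onto this point
  gives a countable base. For a \<open>csf\<close>-countable sequential \<open>\<alpha>\<^sub>7\<close>-space, finite unions of members of a
  \<open>cs\<close>-network provide countably many arbitrarily small sets containing a tail of every sequence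
  tending to the point; composing the translation-invariant relations defined by such sets produces
  open neighborhoods, as in the proof that weakly first-countable topological groups are
  first-countable.
\<close>

section \<open>Convergence and countability\<close>

text \<open>The main difference from topological groups is the stabilizer: many automorphisms of
  \<open>G/H\<close> may carry one point to another, so group expressions are replaced by unions
  over all of them. These stay small because every automorphism preserves each entourage exactly, so
  a bound at one point holds for all translates. A second obstacle is that left translations of a
  gyrogroup compose only up to a gyration. Gyration-invariant neighborhoods and the condition that
  \<open>H\<close> is strong absorb this error. A third is that the sets made from a cs-network need
  not be neighborhoods: they can be tested only by sequences, until sequentiality turns a union of
  them into an open set. Finally, the alpha_7 property does not prescribe the limit of the sequence
  that it yields, so the sheaf is thinned beforehand to exclude limits other than the
  vertex.\<close>

definition sequential_neighborhood :: "'a topology \<Rightarrow> 'a \<Rightarrow> 'a set \<Rightarrow> bool" where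
  "sequential_neighborhood X x B \<longleftrightarrow>
     B \<subseteq> topspace X \<and>
     (\<forall>s. converging_sequence X (topspace X) s x \<longrightarrow> (\<forall>\<^sub>F n in sequentially. s n \<in> B))"

lemma converging_sequence_mono:
  "converging_sequence X A s x \<Longrightarrow> A \<subseteq> B \<Longrightarrow> B \<subseteq> topspace X \<Longrightarrow> converging_sequence X B s x"
  unfolding converging_sequence_def by blast

lemma converging_sequence_subsequence:
  assumes "converging_sequence X A s x" "strict_mono r" "\<And>n. s (r n) \<in> B" "B \<subseteq> topspace X"
  shows "converging_sequence X B (s \<circ> r) x"
  using assms limitin_subsequence unfolding converging_sequence_def by fastforce

lemma converging_sequence_const:
  "x \<in> topspace X \<Longrightarrow> converging_sequence X (topspace X) (\<lambda>n. x) x"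
  by (auto simp: converging_sequence_def)

lemma converging_sequence_continuous_map:
  assumes "continuous_map X Y f" "converging_sequence X (topspace X) s x"
  shows "converging_sequence Y (topspace Y) (f \<circ> s) (f x)"
  using assms continuous_map_limit[OF assms(1)] continuous_map_image_subset_topspace[OF assms(1)]
  unfolding converging_sequence_def by fastforce

lemma sequential_neighborhood_mem:
  assumes "sequential_neighborhood X x B" "x \<in> topspace X"
  shows "x \<in> B"
  using assms converging_sequence_const[of x X] unfolding sequential_neighborhood_def by fastforce

lemma sequential_neighborhood_Inter:
  assumes "finite \<F>" "\<F> \<noteq> {}" "\<And>B. B \<in> \<F> \<Longrightarrow> sequential_neighborhood X x B"
  shows "sequential_neighborhood X x (\<Inter>\<F>)"
  using assms by (auto simp: sequential_neighborhood_def eventually_ball_finite_distrib)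

lemma frequently_imp_strict_mono_subsequence:
  assumes "\<not> (\<forall>\<^sub>F n in sequentially. \<not> P n)"
  obtains r :: "nat \<Rightarrow> nat" where "strict_mono r" "\<And>n. P (r n)"
proof -
  have inf: "infinite {n. P n}"
    using assms by (simp add: frequently_cofinite[symmetric] cofinite_eq_sequentially frequently_def)
  show thesis
    by (rule that[of "enumerate {n. P n}"])
       (use inf enumerate_in_set[OF inf] in \<open>auto simp: strict_mono_enumerate\<close>)
qed

lemma not_sequential_neighborhood:
  assumes "\<not> sequential_neighborhood X x B" "B \<subseteq> topspace X"
  obtains s where "converging_sequence X (topspace X - B) s x"
proof -
  obtain s where s: "converging_sequence X (topspace X) s x" "\<not> (\<forall>\<^sub>F n in sequentially. s n \<in> B)"
    using assms unfolding sequential_neighborhood_def by blast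
  then obtain r :: "nat \<Rightarrow> nat" where r: "strict_mono r" "\<And>n. s (r n) \<notin> B"
    using frequently_imp_strict_mono_subsequence[of "\<lambda>n. s n \<notin> B"] by auto
  have "converging_sequence X (topspace X - B) (s \<circ> r) x"
    by (rule converging_sequence_subsequence[OF s(1) r(1)])
       (use r(2) s(1) in \<open>auto simp: converging_sequence_def\<close>)
  then show thesis by (rule that)
qed

text \<open>If \<open>W\<close> is not open, a sequence outside \<open>W\<close> tends to some
  \<open>y \<in> W\<close>, yet it must eventually enter the sequential neighborhood of
  \<open>y\<close> inside \<open>W\<close>.\<close>

lemma openin_sequential_space:
  assumes "sequential_space X" "W \<subseteq> topspace X"
    and "\<And>y. y \<in> W \<Longrightarrow> \<exists>B. sequential_neighborhood X y B \<and> B \<subseteq> W"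
  shows "openin X W"
proof (rule ccontr)
  assume "\<not> openin X W"
  then have "\<not> closedin X (topspace X - W)"
    using assms(2) openin_closedin_eq by blast
  then obtain y s where y: "y \<in> topspace X - (topspace X - W)"
    and s: "converging_sequence X (topspace X - W) s y"
    using assms(1) unfolding sequential_space_def by (meson Diff_subset)
  obtain B where B: "sequential_neighborhood X y B" "B \<subseteq> W"
    using assms(3) y by blast
  have "\<forall>\<^sub>F n in sequentially. s n \<in> B"
    using B(1) converging_sequence_mono[OF s] unfolding sequential_neighborhood_def by blast
  then obtain n where "s n \<in> B"
    using eventually_happens trivial_limit_sequentially by blast
  moreover have "s n \<notin> W"
    using s unfolding converging_sequence_def by blast
  ultimately show False using B(2) by blast
qed

text \<open>Each \<open>B n\<close> is kept as a nonempty finite intersection so that openness, or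
  being a sequential neighborhood, passes from the members of \<open>\<S>\<close> to it.\<close>

lemma countable_decreasing_intersections:
  assumes "countable \<S>" "\<S> \<noteq> {}"
  obtains B :: "nat \<Rightarrow> 'a set" where "decseq B"
    "\<And>n. \<exists>\<F>. finite \<F> \<and> \<F> \<noteq> {} \<and> \<F> \<subseteq> \<S> \<and> B n = \<Inter>\<F>"
    "\<And>S. S \<in> \<S> \<Longrightarrow> \<exists>n. B n \<subseteq> S"
proof
  let ?B = "\<lambda>n. \<Inter>(from_nat_into \<S> ` {..n})"
  show "decseq ?B"
    by (rule decseq_SucI) auto
  show "\<exists>\<F>. finite \<F> \<and> \<F> \<noteq> {} \<and> \<F> \<subseteq> \<S> \<and> ?B n = \<Inter>\<F>" for n
    using from_nat_into[OF assms(2)] by (intro exI[of _ "from_nat_into \<S> ` {..n}"]) auto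
  show "\<exists>n. ?B n \<subseteq> S" if "S \<in> \<S>" for S
    using from_nat_into_surj[OF assms(1) that] by blast
qed

section \<open>Generalized countability properties\<close>

text \<open>Accumulation at \<open>x\<close> says that every open set around \<open>x\<close> meets
  every member of the prefilter, so a countable base at \<open>x\<close> is itself the required
  prefilter.\<close>

lemma first_countable_imp_bisequential:
  assumes "first_countable X"
  shows "bisequential X"
  unfolding bisequential_def
proof (intro allI ballI impI, elim conjE)
  fix \<zeta> x
  assume x: "x \<in> topspace X" and \<zeta>: "prefilter_on X \<zeta>" "prefilter_accumulates X \<zeta> x"
  obtain \<B> where \<B>: "countable \<B>" "\<And>V. V \<in> \<B> \<Longrightarrow> openin X V"
    "\<And>U. openin X U \<Longrightarrow> x \<in> U \<Longrightarrow> \<exists>V\<in>\<B>. x \<in> V \<and> V \<subseteq> U"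
    using assms x unfolding first_countable_def by metis
  define \<eta> where "\<eta> = {V \<in> \<B>. x \<in> V}"
  have "prefilter_on X \<eta>"
    unfolding prefilter_on_def
  proof (intro conjI ballI)
    show "\<eta> \<noteq> {}" using \<B>(3)[of "topspace X"] x by (auto simp: \<eta>_def)
    show "P \<noteq> {}" "P \<subseteq> topspace X" if "P \<in> \<eta>" for P
      using that \<B>(2) openin_subset unfolding \<eta>_def by blast+
    show "\<exists>P\<in>\<eta>. P \<subseteq> P1 \<inter> P2" if "P1 \<in> \<eta>" "P2 \<in> \<eta>" for P1 P2
      using that \<B>(2) \<B>(3)[of "P1 \<inter> P2"] by (auto simp: \<eta>_def)
  qed
  moreover have "prefilter_converges X \<eta> x"
    using \<B>(3) unfolding prefilter_converges_def \<eta>_def by blast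
  moreover have "synchronous \<zeta> \<eta>"
    using \<zeta>(2) \<B>(2) unfolding synchronous_def prefilter_accumulates_def in_closure_of \<eta>_def
    by blast
  ultimately show "\<exists>\<eta>. prefilter_on X \<eta> \<and> countable \<eta> \<and> prefilter_converges X \<eta> x \<and> synchronous \<zeta> \<eta>"
    using \<B>(1) by (auto simp: \<eta>_def)
qed

lemma first_countable_imp_weakly_first_countable:
  assumes "first_countable X"
  shows "weakly_first_countable X"
proof -
  have "\<exists>B :: nat \<Rightarrow> 'a set. (\<forall>n. x \<in> B n \<and> openin X (B n) \<and> B (Suc n) \<subseteq> B n) \<and>
          (\<forall>U. openin X U \<and> x \<in> U \<longrightarrow> (\<exists>n. B n \<subseteq> U))" if x: "x \<in> topspace X" for x
  proof -
    obtain \<B> where \<B>: "countable \<B>" "\<And>V. V \<in> \<B> \<Longrightarrow> openin X V"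
      "\<And>U. openin X U \<Longrightarrow> x \<in> U \<Longrightarrow> \<exists>V\<in>\<B>. x \<in> V \<and> V \<subseteq> U"
      using assms x unfolding first_countable_def by metis
    let ?\<S> = "{V \<in> \<B>. x \<in> V}"
    have "countable ?\<S>" "?\<S> \<noteq> {}"
      using \<B>(1) \<B>(3)[of "topspace X"] x by auto
    then obtain B :: "nat \<Rightarrow> 'a set" where B: "decseq B"
      "\<And>n. \<exists>\<F>. finite \<F> \<and> \<F> \<noteq> {} \<and> \<F> \<subseteq> ?\<S> \<and> B n = \<Inter>\<F>"
      "\<And>S. S \<in> ?\<S> \<Longrightarrow> \<exists>n. B n \<subseteq> S"
      by (rule countable_decreasing_intersections) (rule that)
    have "x \<in> B n \<and> openin X (B n)" for n
    proof -
      obtain \<F> where F: "finite \<F>" "\<F> \<noteq> {}" "\<F> \<subseteq> ?\<S>" "B n = \<Inter>\<F>"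
        using B(2)[of n] by (elim exE conjE) (rule that)
      have "openin X (\<Inter>\<F>)"
        using F(1-3) \<B>(2) by (intro openin_Inter) blast+
      then show ?thesis
        using F(3,4) by auto
    qed
    moreover have "\<exists>n. B n \<subseteq> U" if U: "openin X U" "x \<in> U" for U
    proof -
      obtain V where "V \<in> ?\<S>" "V \<subseteq> U" using \<B>(3)[OF U] by blast
      moreover obtain k where "B k \<subseteq> V" using B(3)[OF \<open>V \<in> ?\<S>\<close>] by (elim exE) (rule that)
      ultimately show ?thesis by (intro exI[of _ k]) (rule order_trans)
    qed
    ultimately show ?thesis
      using B(1) by (intro exI[of _ B]) (auto simp: decseq_Suc_iff)
  qed
  then obtain B :: "'a \<Rightarrow> nat \<Rightarrow> 'a set" where B:
    "\<And>x n. x \<in> topspace X \<Longrightarrow> x \<in> B x n \<and> openin X (B x n) \<and> B x (Suc n) \<subseteq> B x n"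
    "\<And>x U. x \<in> topspace X \<Longrightarrow> openin X U \<Longrightarrow> x \<in> U \<Longrightarrow> \<exists>n. B x n \<subseteq> U"
    by metis
  show ?thesis
    unfolding weakly_first_countable_def
  proof (intro exI[of _ "\<lambda>n x. B x n"] conjI ballI allI impI iffI)
    show "\<exists>n. B x n \<subseteq> U" if "U \<subseteq> topspace X" "openin X U" "x \<in> U" for U x
      using B(2) that by blast
    show "openin X U" if "U \<subseteq> topspace X" "\<forall>x\<in>U. \<exists>n. B x n \<subseteq> U" for U
      using that B(1) openin_subopen[of X U] by (meson subsetD)
  qed (use B(1) openin_subset in blast)+
qed

text \<open>If a sequence tending to \<open>x\<close> avoided \<open>B n x\<close>, then the complement of its range would be open,
  since the range together with \<open>x\<close> is closed.\<close>

lemma weak_base_sequential_neighborhood: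
  assumes "Hausdorff_space X"
    and B: "\<And>x n. x \<in> topspace X \<Longrightarrow> x \<in> B n x \<and> B n x \<subseteq> topspace X"
    and openin_iff: "\<And>U. U \<subseteq> topspace X \<Longrightarrow> openin X U \<longleftrightarrow> (\<forall>x\<in>U. \<exists>n. B n x \<subseteq> U)"
    and x: "x \<in> topspace X"
  shows "sequential_neighborhood X x (B n x)"
proof (rule ccontr)
  assume "\<not> sequential_neighborhood X x (B n x)"
  then obtain s where s: "converging_sequence X (topspace X - B n x) s x"
    using not_sequential_neighborhood B[OF x] by metis
  have lim: "limitin X s x sequentially" and s_out: "range s \<subseteq> topspace X - B n x"
    using s by (auto simp: converging_sequence_def)
  \<comment> \<open>Hausdorff separation from \<open>x\<close> leaves only finitely many terms near
    \<open>y\<close>, and these form a closed set that can be removed.\<close>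
  have nonlim: "\<exists>U. openin X U \<and> y \<in> U \<and> U \<inter> range s \<subseteq> {y}"
    if y: "y \<in> topspace X" "y \<noteq> x" for y
  proof -
    obtain U V where UV: "openin X U" "openin X V" "y \<in> U" "x \<in> V" "disjnt U V"
      using assms(1) y x unfolding Hausdorff_space_def by metis
    obtain N where N: "\<And>n. n \<ge> N \<Longrightarrow> s n \<in> V"
      using lim UV unfolding limitin_sequentially by blast
    have fin: "finite (s ` {..<N} - {y})" by simp
    have "closedin X (s ` {..<N} - {y})"
      using Hausdorff_imp_t1_space[OF assms(1)] s_out fin unfolding t1_space_closedin_finite
      by blast
    then have "openin X (U - (s ` {..<N} - {y}))"
      using UV(1) by (rule openin_diff[rotated])
    moreover have "(U - (s ` {..<N} - {y})) \<inter> range s \<subseteq> {y}"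
    proof
      fix z assume z: "z \<in> (U - (s ` {..<N} - {y})) \<inter> range s"
      then obtain m where m: "z = s m" by blast
      have "m < N" using N[of m] z m UV(5) unfolding disjnt_def by (meson IntD1 DiffD1 disjoint_iff not_le)
      then show "z \<in> {y}" using z m by blast
    qed
    ultimately show ?thesis
      using UV(3) by blast
  qed
  have "openin X (topspace X - range s)"
  proof (subst openin_iff; safe?)
    fix y assume y: "y \<in> topspace X" "y \<notin> range s"
    show "\<exists>m. B m y \<subseteq> topspace X - range s"
    \<comment> \<open>At \<open>y = x\<close> the witness is \<open>B n x\<close> itself. It is not
      known to be a neighborhood, but the weak base accepts it, and this makes the complement of the
      range open around the limit.\<close>
    proof (cases "y = x")
      case True
      then show ?thesis using s_out B[OF x] by blast
    next
      case False
      then obtain U where U: "openin X U" "y \<in> U" "U \<inter> range s \<subseteq> {y}"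
        using nonlim y by blast
      then obtain m where "B m y \<subseteq> U"
        using openin_iff[OF openin_subset[OF U(1)]] by blast
      then show ?thesis using U y B[OF y(1)] by blast
    qed
  qed
  moreover have "x \<in> topspace X - range s"
    using s_out B[OF x] by blast
  ultimately obtain N where "\<And>n. n \<ge> N \<Longrightarrow> s n \<in> topspace X - range s"
    using lim unfolding limitin_sequentially by blast
  then show False by blast
qed

text \<open>The sets \<open>B n x\<close> form a cs-network because they are sequential
  neighborhoods. A choice of one point from each of them tends to \<open>x\<close>, which yields
  sequentiality and, applied to a diagonal of the sheaf, the alpha_7 property with limit
  \<open>x\<close>.\<close>

lemma weakly_first_countable_imp_csf_sequential_alpha7:
  assumes "Hausdorff_space X" "weakly_first_countable X"
  shows "csf_countable X \<and> sequential_space X \<and> alpha7_space X"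
proof -
  obtain B :: "nat \<Rightarrow> 'a \<Rightarrow> 'a set" where
    B: "\<And>x n. x \<in> topspace X \<Longrightarrow> x \<in> B n x \<and> B n x \<subseteq> topspace X"
    and dec: "\<And>x n. x \<in> topspace X \<Longrightarrow> B (Suc n) x \<subseteq> B n x"
    and openin_iff: "\<And>U. U \<subseteq> topspace X \<Longrightarrow> openin X U \<longleftrightarrow> (\<forall>x\<in>U. \<exists>n. B n x \<subseteq> U)"
    using assms(2) unfolding weakly_first_countable_def by metis
  note nbhd = weak_base_sequential_neighborhood[OF assms(1) B openin_iff]
  have dec: "B n x \<subseteq> B m x" if "x \<in> topspace X" "m \<le> n" for x m n
    using lift_Suc_antimono_le[of "\<lambda>n. B n x"] dec that by blast
  have conv: "converging_sequence X A s x"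
    if x: "x \<in> topspace X" and A: "A \<subseteq> topspace X" "range s \<subseteq> A" and s: "\<And>n. s n \<in> B n x" for A s x
    unfolding converging_sequence_def limitin_sequentially
  proof (intro conjI allI impI A x)
    fix U assume U: "openin X U \<and> x \<in> U"
    then obtain n where "B n x \<subseteq> U" using openin_iff openin_subset by metis
    then show "\<exists>N. \<forall>n\<ge>N. s n \<in> U" using s dec[OF x] by blast
  qed
  have "csf_countable X"
    unfolding csf_countable_def
  proof (intro ballI exI conjI)
    fix x assume x: "x \<in> topspace X"
    show "cs_network_at X x (range (\<lambda>n. B n x))"
      unfolding cs_network_at_def
    proof (intro conjI ballI allI impI)
      fix L U
      assume LU: "converging_sequence X (topspace X) L x \<and> neighborhood_in X x U"
      then obtain W where W: "openin X W" "x \<in> W" "W \<subseteq> U" unfolding neighborhood_in_def by blast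
      then obtain n where "B n x \<subseteq> W" using openin_iff openin_subset by metis
      then show "\<exists>P\<in>range (\<lambda>n. B n x). P \<subseteq> U \<and> (\<forall>\<^sub>F n in sequentially. L n \<in> P)"
        using W nbhd[OF _ _ x] LU unfolding sequential_neighborhood_def by blast
    qed (use B[OF x] in auto)
  qed auto
  moreover have "sequential_space X"
    unfolding sequential_space_def
  proof (intro allI impI, elim conjE)
    fix A assume A: "A \<subseteq> topspace X" "\<not> closedin X A"
    then have "\<not> openin X (topspace X - A)"
      unfolding closedin_def by blast
    then obtain x where x: "x \<in> topspace X - A" "\<And>n. \<not> B n x \<subseteq> topspace X - A"
      using openin_iff[of "topspace X - A"] by blast
    have "\<exists>a. a \<in> B n x \<inter> A" for n using x B[of x n] by blast
    then obtain s where "\<And>n. s n \<in> B n x \<inter> A" by metis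
    then have "converging_sequence X A s x"
      using x A by (intro conv) auto
    then show "\<exists>x\<in>topspace X - A. \<exists>s. converging_sequence X A s x" using x by blast
  qed
  moreover have "alpha7_space X"
    unfolding alpha7_space_def
  proof (intro ballI allI impI)
    fix x S assume x: "x \<in> topspace X" and S: "sheaf_with_vertex X x S"
    have "\<exists>k. S n k \<in> B n x" for n
    proof -
      have "converging_sequence X (topspace X) (S n) x"
        using S unfolding sheaf_with_vertex_def by (meson converging_sequence_mono Diff_subset order_refl)
      then have "\<forall>\<^sub>F k in sequentially. S n k \<in> B n x"
        using nbhd[OF _ _ x] unfolding sequential_neighborhood_def by blast
      then show ?thesis using eventually_happens trivial_limit_sequentially by blast
    qed
    then obtain k where k: "\<And>n. S n (k n) \<in> B n x" by metis
    then have "converging_sequence X (topspace X) (\<lambda>n. S n (k n)) x"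
      using B[OF x] by (intro conv x) auto
    moreover have "{n. range (\<lambda>n. S n (k n)) \<inter> range (S n) \<noteq> {}} = UNIV" by auto
    ultimately show "\<exists>L. \<exists>y\<in>topspace X. converging_sequence X (topspace X) L y \<and>
           infinite {n. range L \<inter> range (S n) \<noteq> {}}"
      using x by (metis infinite_UNIV_nat)
  qed
  ultimately show ?thesis by blast
qed

section \<open>Homogeneous uniformities\<close>

text \<open>The equivalence makes the inverse homeomorphism preserve the entourages too.\<close>

definition entourage_automorphism :: "'a topology \<Rightarrow> 'a rel set \<Rightarrow> ('a \<Rightarrow> 'a) \<Rightarrow> bool" where
  "entourage_automorphism X \<D> f \<longleftrightarrow>
     homeomorphic_map X X f \<and>
     (\<forall>E\<in>\<D>. \<forall>x\<in>topspace X. \<forall>y\<in>topspace X. (f x, f y) \<in> E \<longleftrightarrow> (x, y) \<in> E)"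

lemma entourage_automorphism_comp:
  assumes "entourage_automorphism X \<D> f" "entourage_automorphism X \<D> g"
  shows "entourage_automorphism X \<D> (g \<circ> f)"
proof -
  have f: "homeomorphic_map X X f" and g: "homeomorphic_map X X g"
    using assms by (simp_all add: entourage_automorphism_def)
  have "f x \<in> topspace X" if "x \<in> topspace X" for x
    using that by (rule funcset_mem[OF continuous_map_funspace[OF homeomorphic_imp_continuous_map[OF f]]])
  then show ?thesis
    using assms homeomorphic_map_compose[OF f g] by (simp add: entourage_automorphism_def)
qed

text \<open>The model is the left uniformity of a topological group, where every left translation
  preserves each basic entourage.\<close>

locale homogeneous_uniformity =
  fixes X :: "'a topology" and \<D> :: "'a rel set"
  assumes t1: "t1_space X"
    and entourage_subset: "E \<in> \<D> \<Longrightarrow> E \<subseteq> topspace X \<times> topspace X"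
    and entourage_refl: "E \<in> \<D> \<Longrightarrow> x \<in> topspace X \<Longrightarrow> (x, x) \<in> E"
    and entourage_sym: "E \<in> \<D> \<Longrightarrow> (x, y) \<in> E \<Longrightarrow> (y, x) \<in> E"
    and entourage_half: "E \<in> \<D> \<Longrightarrow> \<exists>F\<in>\<D>. F O F \<subseteq> E"
    and entourage_open: "E \<in> \<D> \<Longrightarrow> x \<in> topspace X \<Longrightarrow> openin X (E `` {x})"
    and entourage_base: "openin X W \<Longrightarrow> x \<in> W \<Longrightarrow> \<exists>E\<in>\<D>. E `` {x} \<subseteq> W"
    and transitive: "x \<in> topspace X \<Longrightarrow> y \<in> topspace X \<Longrightarrow>
          \<exists>f. entourage_automorphism X \<D> f \<and> f x = y"
begin

abbreviation "aut \<equiv> entourage_automorphism X \<D>"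

lemma aut_entourage:
  assumes "aut f" "E \<in> \<D>" "(x, y) \<in> E"
  shows "(f x, f y) \<in> E"
proof -
  have "x \<in> topspace X" "y \<in> topspace X"
    using entourage_subset[OF assms(2)] assms(3) by auto
  then show ?thesis
    using assms unfolding entourage_automorphism_def by simp
qed

lemma aut_homeomorphic: "aut f \<Longrightarrow> homeomorphic_map X X f"
  by (simp add: entourage_automorphism_def)

lemma aut_continuous: "aut f \<Longrightarrow> continuous_map X X f"
  by (rule homeomorphic_imp_continuous_map[OF aut_homeomorphic])

lemma aut_mem: "aut f \<Longrightarrow> x \<in> topspace X \<Longrightarrow> f x \<in> topspace X"
  by (rule funcset_mem[OF continuous_map_funspace[OF aut_continuous]])

lemma aut_inverse:
  assumes "aut f"
  obtains g where "aut g" "\<And>x. x \<in> topspace X \<Longrightarrow> g (f x) = x" "\<And>x. x \<in> topspace X \<Longrightarrow> f (g x) = x"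
proof -
  obtain g where "homeomorphic_maps X X f g"
    using aut_homeomorphic[OF assms] homeomorphic_map_maps by blast
  then have g: "homeomorphic_map X X g"
    "\<And>x. x \<in> topspace X \<Longrightarrow> g (f x) = x" "\<And>x. x \<in> topspace X \<Longrightarrow> f (g x) = x"
    unfolding homeomorphic_maps_map by simp_all
  have mem: "g x \<in> topspace X" if "x \<in> topspace X" for x
    by (rule funcset_mem[OF continuous_map_funspace[OF homeomorphic_imp_continuous_map[OF g(1)]] that])
  have "aut g"
    unfolding entourage_automorphism_def
  proof (intro conjI ballI g(1))
    fix E x y assume "E \<in> \<D>" "x \<in> topspace X" "y \<in> topspace X"
    then show "(g x, g y) \<in> E \<longleftrightarrow> (x, y) \<in> E"
      using assms mem g(3) unfolding entourage_automorphism_def by metis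
  qed
  then show thesis using g that by blast
qed

lemma aut_openin:
  assumes "aut f" "openin X W"
  shows "openin X (f ` W)"
  using homeomorphic_imp_open_map[OF aut_homeomorphic[OF assms(1)]] assms(2)
  by (simp add: open_map_def)

text \<open>Four steps fit the paths used below: \<open>v Q\<close>, \<open>a\<close>,
  \<open>x\<close>, \<open>b\<close>, \<open>w\<close> in the bisequential case and
  \<open>y\<close>, \<open>z\<close>, \<open>g x\<close>, \<open>a\<close>, \<open>e\<close> for
  \<open>translates_through\<close>. Some of their steps are reversed by symmetry.\<close>

lemma entourage_quarter:
  assumes "E \<in> \<D>"
  obtains F where "F \<in> \<D>"
    "\<And>a b c d z. (a, b) \<in> F \<Longrightarrow> (b, c) \<in> F \<Longrightarrow> (c, d) \<in> F \<Longrightarrow> (d, z) \<in> F \<Longrightarrow> (a, z) \<in> E"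
proof -
  obtain F' where F': "F' \<in> \<D>" "F' O F' \<subseteq> E"
    using entourage_half[OF assms] by blast
  obtain F where F: "F \<in> \<D>" "F O F \<subseteq> F'"
    using entourage_half[OF F'(1)] by blast
  have "(a, z) \<in> E" if "(a, b) \<in> F" "(b, c) \<in> F" "(c, d) \<in> F" "(d, z) \<in> F" for a b c d z
    using F(2) F'(2) relcompI[OF that(1,2)] relcompI[OF that(3,4)] by blast
  then show thesis by (rule that[OF F(1)])
qed

lemma closure_of_entourage:
  assumes "E \<in> \<D>" "y \<in> X closure_of A"
  obtains a where "a \<in> A" "(a, y) \<in> E"
proof -
  have y: "y \<in> topspace X" using assms(2) in_closure_of by metis
  then have "y \<in> E `` {y}" "openin X (E `` {y})"
    using assms(1) entourage_refl entourage_open by blast+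
  then obtain a where "a \<in> A" "a \<in> E `` {y}"
    using assms(2) unfolding in_closure_of by blast
  then show thesis using that entourage_sym[OF assms(1)] by blast
qed

lemma Hausdorff: "Hausdorff_space X"
  unfolding Hausdorff_space_def
proof (intro allI impI, elim conjE)
  fix x y assume x: "x \<in> topspace X" and y: "y \<in> topspace X" and "x \<noteq> y"
  have "openin X (topspace X - {y})"
    using closedin_t1_singleton[OF t1 y] by blast
  then obtain E where E: "E \<in> \<D>" "E `` {x} \<subseteq> topspace X - {y}"
    using entourage_base x \<open>x \<noteq> y\<close> by blast
  obtain F where F: "F \<in> \<D>" "F O F \<subseteq> E"
    using entourage_half[OF E(1)] by blast
  have "disjnt (F `` {x}) (F `` {y})"
    using F E(2) entourage_sym[OF F(1)] unfolding disjnt_def by blast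
  then show "\<exists>U V. openin X U \<and> openin X V \<and> x \<in> U \<and> y \<in> V \<and> disjnt U V"
    using entourage_open[OF F(1)] entourage_refl[OF F(1)] x y by (meson Image_singleton_iff)
qed

section \<open>First countability from bisequentiality\<close>

text \<open>A set that meets every dense open set cannot be nowhere dense. The interior of its
  closure need not contain \<open>x\<close>, so one of its points is moved to \<open>x\<close>;
  invariance of the entourages keeps its size under control.\<close>

lemma bisequential_imp_first_countable:
  assumes "bisequential X"
  shows "first_countable X"
  unfolding first_countable_def
proof
  fix x assume x: "x \<in> topspace X"
  define \<zeta> where "\<zeta> = {D. openin X D \<and> X closure_of D = topspace X}"
  have "prefilter_on X \<zeta>"
    unfolding prefilter_on_def
  proof (intro conjI ballI)
    show "\<zeta> \<noteq> {}" by (auto simp: \<zeta>_def)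
    show "P \<noteq> {}" "P \<subseteq> topspace X" if "P \<in> \<zeta>" for P
      using that x openin_subset by (auto simp: \<zeta>_def)
    show "\<exists>P\<in>\<zeta>. P \<subseteq> P1 \<inter> P2" if P: "P1 \<in> \<zeta>" "P2 \<in> \<zeta>" for P1 P2
    proof
      have "P1 \<inter> P2 \<inter> W \<noteq> {}" if "openin X W" "W \<noteq> {}" for W
      proof -
        have "openin X (P2 \<inter> W)" "P2 \<inter> W \<noteq> {}"
          using P that by (auto simp: \<zeta>_def dense_intersects_open openin_Int)
        then show ?thesis
          using P by (auto simp: \<zeta>_def dense_intersects_open Int_assoc)
      qed
      then show "P1 \<inter> P2 \<in> \<zeta>"
        using P by (auto simp: \<zeta>_def dense_intersects_open openin_Int)
    qed simp
  qed
  moreover have "prefilter_accumulates X \<zeta> x"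
    using x by (auto simp: prefilter_accumulates_def \<zeta>_def)
  ultimately obtain \<eta> where \<eta>: "prefilter_on X \<eta>" "countable \<eta>" "prefilter_converges X \<eta> x"
    "synchronous \<zeta> \<eta>"
    using assms x unfolding bisequential_def by metis
  have "\<exists>v. v \<in> X interior_of (X closure_of Q)" if Q: "Q \<in> \<eta>" for Q
  proof (rule ccontr)
    assume "\<not> ?thesis"
    then have "topspace X - X closure_of Q \<in> \<zeta>"
      by (auto simp: \<zeta>_def closure_of_complement)
    then have "(topspace X - X closure_of Q) \<inter> Q \<noteq> {}"
      using \<eta>(4) Q unfolding synchronous_def by blast
    moreover have "Q \<subseteq> X closure_of Q"
      using \<eta>(1) Q unfolding prefilter_on_def by (simp add: closure_of_subset)
    ultimately show False by blast
  qed
  then obtain v where v: "\<And>Q. Q \<in> \<eta> \<Longrightarrow> v Q \<in> X interior_of (X closure_of Q)"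
    by metis
  then have "v Q \<in> topspace X" if "Q \<in> \<eta>" for Q
    using that interior_of_subset_topspace by fastforce
  then have "\<forall>Q\<in>\<eta>. \<exists>f. aut f \<and> f (v Q) = x"
    using transitive[OF _ x] by simp
  then obtain f where "\<forall>Q\<in>\<eta>. aut (f Q) \<and> f Q (v Q) = x"
    by (rule bchoice[THEN exE]) (rule that)
  then have f: "aut (f Q) \<and> f Q (v Q) = x" if "Q \<in> \<eta>" for Q
    using that by blast
  define N where "N Q = f Q ` (X interior_of (X closure_of Q))" for Q
  have "\<exists>Q\<in>\<eta>. x \<in> N Q \<and> N Q \<subseteq> U" if U: "openin X U" "x \<in> U" for U
  proof -
    obtain E where E: "E \<in> \<D>" "E `` {x} \<subseteq> U"
      using entourage_base[OF U] by blast
    obtain F where F: "F \<in> \<D>"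
      "\<And>a b c d z. (a, b) \<in> F \<Longrightarrow> (b, c) \<in> F \<Longrightarrow> (c, d) \<in> F \<Longrightarrow> (d, z) \<in> F \<Longrightarrow> (a, z) \<in> E"
      by (rule entourage_quarter[OF E(1)]) (rule that)
    have "x \<in> F `` {x}" using entourage_refl[OF F(1) x] by simp
    then have "\<exists>Q\<in>\<eta>. Q \<subseteq> F `` {x}"
      using \<eta>(3) entourage_open[OF F(1) x] by (simp add: prefilter_converges_def)
    then obtain Q where Q: "Q \<in> \<eta>" "Q \<subseteq> F `` {x}" ..
    \<comment> \<open>Every point of the interior is two \<open>F\<close>-steps away from
      \<open>x\<close>, so any two of them are \<open>E\<close>-close.\<close>
    have near: "\<exists>a\<in>Q. (a, w) \<in> F \<and> (x, a) \<in> F" if "w \<in> X interior_of (X closure_of Q)" for w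
    proof -
      have "w \<in> X closure_of Q" by (rule subsetD[OF interior_of_subset that])
      then obtain a where "a \<in> Q" "(a, w) \<in> F"
        by (rule closure_of_entourage[OF F(1)]) (rule that)
      then show ?thesis using Q(2) by auto
    qed
    have fQ: "aut (f Q)" "f Q (v Q) = x" using f[OF Q(1)] by simp_all
    have "f Q w \<in> U" if w: "w \<in> X interior_of (X closure_of Q)" for w
    proof -
      obtain a where a: "(a, v Q) \<in> F" "(x, a) \<in> F" using near[OF v[OF Q(1)]] by auto
      obtain b where b: "(b, w) \<in> F" "(x, b) \<in> F" using near[OF w] by auto
      have "(v Q, w) \<in> E"
        by (rule F(2)[OF entourage_sym[OF F(1) a(1)] entourage_sym[OF F(1) a(2)] b(2) b(1)])
      then have "(x, f Q w) \<in> E" using aut_entourage[OF fQ(1) E(1)] fQ(2) by metis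
      then show ?thesis using E(2) by auto
    qed
    then have "N Q \<subseteq> U" unfolding N_def by auto
    moreover have "x \<in> N Q" using imageI[OF v[OF Q(1)], of "f Q"] fQ(2) unfolding N_def by simp
    ultimately show ?thesis using Q(1) by auto
  qed
  moreover have "openin X (N Q)" if "Q \<in> \<eta>" for Q
    unfolding N_def using aut_openin[OF conjunct1[OF f[OF that]] openin_interior_of] .
  ultimately show "\<exists>\<B>. countable \<B> \<and> (\<forall>V\<in>\<B>. openin X V) \<and>
      (\<forall>U. openin X U \<and> x \<in> U \<longrightarrow> (\<exists>V\<in>\<B>. x \<in> V \<and> V \<subseteq> U))"
    using \<eta>(2) by (intro exI[of _ "N ` \<eta>"]) auto
qed

section \<open>Sequential neighborhoods from cs-networks in alpha_7 spaces\<close>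

text \<open>For topological groups with their left translations, this is \<open>x P\<inverse> P\<close>.\<close>

definition translates_through :: "'a \<Rightarrow> 'a set \<Rightarrow> 'a set" where
  "translates_through x P = \<Union>{f ` P |f. aut f \<and> x \<in> f ` P}"

text \<open>With \<open>U\<close> an entourage ball around \<open>x\<close>, all images of
  \<open>P\<close> are uniformly small, and \<open>e\<close> in the closure would be joined to
  \<open>y\<close> by four steps through \<open>z\<close>, \<open>g x\<close> and \<open>a\<close>.
  The choice of \<open>U\<close> precedes that of \<open>P\<close>, \<open>f\<close> and
  \<open>z\<close>, since the network member is later found inside \<open>U\<close>.\<close>

lemma closure_of_translates_through:
  assumes x: "x \<in> topspace X" and y: "y \<in> topspace X" and e: "e \<in> topspace X" "e \<noteq> y"
  obtains U where "openin X U" "x \<in> U"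
    "\<And>P f z. P \<subseteq> U \<Longrightarrow> aut f \<Longrightarrow> f x = y \<Longrightarrow> z \<in> f ` P \<Longrightarrow>
       e \<notin> X closure_of (translates_through z P)"
proof -
  have "openin X (topspace X - {e})"
    using closedin_t1_singleton[OF t1 e(1)] by blast
  then obtain E where E: "E \<in> \<D>" "E `` {y} \<subseteq> topspace X - {e}"
    using entourage_base y e(2) by blast
  obtain F where F: "F \<in> \<D>"
    "\<And>a b c d z. (a, b) \<in> F \<Longrightarrow> (b, c) \<in> F \<Longrightarrow> (c, d) \<in> F \<Longrightarrow> (d, z) \<in> F \<Longrightarrow> (a, z) \<in> E"
    by (rule entourage_quarter[OF E(1)]) (rule that)
  have sym: "\<And>a b. (a, b) \<in> F \<Longrightarrow> (b, a) \<in> F" using entourage_sym[OF F(1)] .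
  show thesis
  proof (rule that)
    show "openin X (F `` {x})" "x \<in> F `` {x}"
      using entourage_open[OF F(1) x] entourage_refl[OF F(1) x] by auto
    fix P f z
    assume P: "P \<subseteq> F `` {x}" and f: "aut f" "f x = y" and z: "z \<in> f ` P"
    show "e \<notin> X closure_of (translates_through z P)"
    proof
      assume "e \<in> X closure_of (translates_through z P)"
      then obtain a where a: "a \<in> translates_through z P" "(a, e) \<in> F"
        using closure_of_entourage[OF F(1)] by blast
      then obtain g where g: "aut g" "z \<in> g ` P" "a \<in> g ` P"
        unfolding translates_through_def by blast
      have "(f x, z) \<in> F" using z P aut_entourage[OF f(1) F(1)] by blast
      moreover have "(g x, z) \<in> F" "(g x, a) \<in> F"
        using g P aut_entourage[OF g(1) F(1)] by blast+
      ultimately have "(y, e) \<in> E"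
        using F(2) sym a(2) f(2) by blast
      then show False using E(2) by blast
    qed
  qed
qed

lemma translates_through_I: "aut f \<Longrightarrow> x \<in> f ` P \<Longrightarrow> z \<in> f ` P \<Longrightarrow> z \<in> translates_through x P"
  unfolding translates_through_def by blast

text \<open>At each step, only finitely many closed sets missing \<open>x\<close> have to be avoided, so every sufficiently
  late term of \<open>S n\<close> can be chosen.\<close>

lemma avoiding_sheaf:
  fixes A :: "nat \<Rightarrow> 'a set" and P :: "nat \<Rightarrow> 'a set"
  assumes x: "x \<in> topspace X"
    and S: "\<And>n. converging_sequence X (A n - {x}) (S n) x"
  obtains g :: "nat \<Rightarrow> 'a" where "inj g"
    "\<And>n. converging_sequence X (A n - {x}) (\<lambda>l. g (prod_encode (n, l))) x"
    "\<And>i m k. i < m \<Longrightarrow> k < m \<Longrightarrow> x \<notin> X closure_of (translates_through (g i) (P k)) \<Longrightarrow>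
       g m \<notin> translates_through (g i) (P k) \<inter> topspace X"
proof -
  \<comment> \<open>The pairing visits every row infinitely often, so an infinite sequence survives
    in each row.\<close>
  define s where "s m = S (fst (prod_decode m))" for m
  have s_conv: "converging_sequence X (A (fst (prod_decode m)) - {x}) (s m) x" for m
    using S by (simp add: s_def)
  have s_mem: "s m k \<in> topspace X" "s m k \<noteq> x" for m k
    using s_conv[of m] unfolding converging_sequence_def by blast+
  \<comment> \<open>The bound \<open>m \<le> r\<close> keeps the thinned rows convergent,
    distinctness of the terms gives \<open>inj g\<close>, and \<open>i < m\<close>,
    \<open>k < m\<close> leave finitely many conditions at stage \<open>m\<close>.\<close>
  define R where "R f m r \<longleftrightarrow> m \<le> r \<and> (\<forall>i<m. s m r \<noteq> s i (f i) \<and>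
      (\<forall>k<m. x \<notin> X closure_of (translates_through (s i (f i)) (P k)) \<longrightarrow>
         s m r \<notin> translates_through (s i (f i)) (P k) \<inter> topspace X))"
    for f :: "nat \<Rightarrow> nat" and m r
  have "\<exists>f. \<forall>m. R f m (f m)"
  proof (rule dependent_wellorder_choice)
    fix r m and f g :: "nat \<Rightarrow> nat"
    assume "\<And>i. i < m \<Longrightarrow> f i = g i"
    then show "R f m r = R g m r" by (simp add: R_def)
  next
    fix m f
    define Z where "Z = {X closure_of (translates_through (s i (f i)) (P k)) |i k. i < m \<and> k < m} \<union>
      (\<lambda>i. {s i (f i)}) ` {..<m}"
    define C where "C = \<Union>{K \<in> Z. x \<notin> K}"
    have "Z = (\<lambda>(i, k). X closure_of (translates_through (s i (f i)) (P k))) ` ({..<m} \<times> {..<m}) \<union>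
      (\<lambda>i. {s i (f i)}) ` {..<m}"
      unfolding Z_def by auto
    then have "finite Z" by simp
    moreover have "closedin X K" if "K \<in> Z" for K
      using that closedin_t1_singleton[OF t1 s_mem(1)] unfolding Z_def by auto
    ultimately have "closedin X C"
      unfolding C_def by (intro closedin_Union) auto
    then have "openin X (topspace X - C)" "x \<in> topspace X - C"
      using x by (auto simp: C_def)
    then obtain N where N: "\<And>n. n \<ge> N \<Longrightarrow> s m n \<in> topspace X - C"
      using s_conv[of m] unfolding converging_sequence_def limitin_sequentially by blast
    have out: "s m (max N m) \<notin> K" if "K \<in> Z" "x \<notin> K" for K
      using N[of "max N m"] that unfolding C_def by auto
    have "R f m (max N m)"
      unfolding R_def
    proof (intro conjI allI impI)
      fix i assume i: "i < m"
      then show "s m (max N m) \<noteq> s i (f i)"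
        using out[of "{s i (f i)}"] s_mem(2)[of i "f i"] unfolding Z_def by auto
      fix k assume k: "k < m" "x \<notin> X closure_of (translates_through (s i (f i)) (P k))"
      then have "s m (max N m) \<notin> X closure_of (translates_through (s i (f i)) (P k))"
        using i by (intro out) (auto simp: Z_def)
      then show "s m (max N m) \<notin> translates_through (s i (f i)) (P k) \<inter> topspace X"
        using closure_of_subset_Int[of X "translates_through (s i (f i)) (P k)"] by blast
    qed simp
    then show "\<exists>r. R f m r" ..
  qed
  then obtain f where f: "\<And>m. R f m (f m)" by blast
  define g where "g m = s m (f m)" for m
  have g: "g m \<noteq> g i" if "i < m" for i m
    using f[of m] that unfolding R_def g_def by blast
  show thesis
  proof
    show "inj g"
      using g by (metis injI linorder_neqE_nat)
    show "converging_sequence X (A n - {x}) (\<lambda>l. g (prod_encode (n, l))) x" for n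
      unfolding converging_sequence_def limitin_sequentially
    proof (intro conjI allI impI)
      have Sn: "A n - {x} \<subseteq> topspace X" "range (S n) \<subseteq> A n - {x}" "limitin X (S n) x sequentially"
        using S[of n] unfolding converging_sequence_def by auto
      have gS: "g (prod_encode (n, l)) = S n (f (prod_encode (n, l)))" for l
        by (simp add: g_def s_def)
      show "A n - {x} \<subseteq> topspace X" by fact
      show "range (\<lambda>l. g (prod_encode (n, l))) \<subseteq> A n - {x}"
        using Sn(2) gS by auto
      show "x \<in> topspace X" by fact
      fix U assume "openin X U \<and> x \<in> U"
      then obtain N where N: "\<And>k. k \<ge> N \<Longrightarrow> S n k \<in> U"
        using Sn(3) unfolding limitin_sequentially by blast
      have "g (prod_encode (n, l)) \<in> U" if "l \<ge> N" for l
      proof -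
        have "l \<le> f (prod_encode (n, l))"
          using f[of "prod_encode (n, l)"] le_prod_encode_2[of l n] unfolding R_def by linarith
        then show ?thesis using N that unfolding gS by auto
      qed
      then show "\<exists>N. \<forall>l\<ge>N. g (prod_encode (n, l)) \<in> U" by blast
    qed
    show "g m \<notin> translates_through (g i) (P k) \<inter> topspace X"
      if "i < m" "k < m" "x \<notin> X closure_of (translates_through (g i) (P k))" for i m k
      using f[of m] that unfolding R_def g_def by blast
  qed
qed

text \<open>By injectivity a value \<open>L j\<close> lies in at most one row. The terms before
  \<open>N\<close> thus use up finitely many rows, and among infinitely many rows met by
  \<open>L\<close> there is another one with index at least \<open>M\<close>.\<close>

lemma alpha7_frequently:
  fixes g L :: "nat \<Rightarrow> 'a"
  assumes "inj g" and inf: "infinite {n. range L \<inter> range (\<lambda>l. g (prod_encode (n, l))) \<noteq> {}}"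
  obtains j n l where "N \<le> j" "M \<le> n" "M \<le> prod_encode (n, l)" "L j = g (prod_encode (n, l))"
proof -
  let ?I = "{n. range L \<inter> range (\<lambda>l. g (prod_encode (n, l))) \<noteq> {}}"
  define h where "h j = fst (prod_decode (inv g (L j)))" for j :: nat
  have h: "h j = n" if "L j = g (prod_encode (n, l))" for j n l
    using that assms(1) by (simp add: h_def)
  have "finite (h ` {..<N} \<union> {..<M})" by simp
  then obtain n where n: "n \<in> ?I" "n \<notin> h ` {..<N} \<union> {..<M}"
    using inf by (meson finite_subset subsetI)
  then obtain j l where jl: "L j = g (prod_encode (n, l))" by auto
  show thesis
  proof (rule that[OF _ _ _ jl])
    show "N \<le> j" using n(2) h[OF jl] by (metis UnI1 imageI lessThan_iff not_le)
    show "M \<le> n" using n(2) by auto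
    then show "M \<le> prod_encode (n, l)" using le_prod_encode_1[of n l] by linarith
  qed
qed

text \<open>If no finite union of members of the \<open>cs\<close>-network contained in \<open>U\<close> worked, there would be
  sequences \<open>S n\<close> tending to \<open>x\<close> and avoiding the first \<open>n\<close> of these members. After the thinning of
  \<open>avoiding_sheaf\<close>, a sequence \<open>L\<close> as in the \<open>\<alpha>\<^sub>7\<close>-property can only tend to \<open>x\<close>, and then a tail
  of it lies in a single member: a contradiction.\<close>

lemma csf_alpha7_sequential_neighborhood:
  assumes x: "x \<in> topspace X" and "alpha7_space X"
    and \<P>: "countable \<P>" "cs_network_at X x \<P>"
    and U: "openin X U" "x \<in> U"
  shows "\<exists>\<F>. finite \<F> \<and> \<F> \<subseteq> \<P> \<and> \<Union>\<F> \<subseteq> U \<and> sequential_neighborhood X x (\<Union>\<F>)"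
proof (rule ccontr)
  assume contra: "\<not> ?thesis"
  have net: "\<exists>P\<in>\<P>. P \<subseteq> V \<and> (\<forall>\<^sub>F n in sequentially. L n \<in> P)"
    if "converging_sequence X (topspace X) L x" "openin X V" "x \<in> V" for L V
  proof -
    have "neighborhood_in X x V"
      using that(2,3) openin_subset unfolding neighborhood_in_def by blast
    then show ?thesis using \<P>(2) that(1) unfolding cs_network_at_def by blast
  qed
  have mem: "P \<subseteq> topspace X" "x \<in> P" if "P \<in> \<P>" for P
    using \<P>(2) that unfolding cs_network_at_def by blast+
  define \<P>U where "\<P>U = {P \<in> \<P>. P \<subseteq> U}"
  define PU where "PU = from_nat_into \<P>U"
  define P where "P = from_nat_into \<P>"
  \<comment> \<open>The constant sequence provides a member inside \<open>U\<close>, so the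
    enumeration \<open>PU\<close> really takes its values among such members.\<close>
  have ne: "\<P>U \<noteq> {}"
    using net[OF converging_sequence_const[OF x] U] unfolding \<P>U_def by blast
  then have PU: "PU n \<in> \<P>" "PU n \<subseteq> U" for n
    using from_nat_into[OF ne, of n] unfolding PU_def \<P>U_def by auto
  have surj: "\<exists>k. P k = Q" if "Q \<in> \<P>" for Q
    using from_nat_into_surj[OF \<P>(1) that] unfolding P_def by blast
  have surjU: "\<exists>k. PU k = Q" if "Q \<in> \<P>" "Q \<subseteq> U" for Q
    using from_nat_into_surj[of \<P>U Q] \<P>(1) that unfolding PU_def \<P>U_def by auto
  define A where "A n = topspace X - \<Union>(PU ` {..n})" for n
  have "\<exists>s. converging_sequence X (A n - {x}) s x" for n
  proof -
    have sub: "finite (PU ` {..n})" "PU ` {..n} \<subseteq> \<P>" "\<Union>(PU ` {..n}) \<subseteq> U"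
      using PU by auto
    then have "\<not> sequential_neighborhood X x (\<Union>(PU ` {..n}))"
      using contra by meson
    moreover have "\<Union>(PU ` {..n}) \<subseteq> topspace X"
      using mem(1) PU(1) by blast
    ultimately obtain s where "converging_sequence X (A n) s x"
      unfolding A_def by (rule not_sequential_neighborhood)
    moreover have "A n - {x} = A n"
      using mem(2) PU(1) unfolding A_def by auto
    ultimately show ?thesis by auto
  qed
  then obtain S where S: "\<And>n. converging_sequence X (A n - {x}) (S n) x" by metis
  obtain g :: "nat \<Rightarrow> 'a" where g: "inj g"
    "\<And>n. converging_sequence X (A n - {x}) (\<lambda>l. g (prod_encode (n, l))) x"
    "\<And>i m k. i < m \<Longrightarrow> k < m \<Longrightarrow> x \<notin> X closure_of (translates_through (g i) (P k)) \<Longrightarrow>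
       g m \<notin> translates_through (g i) (P k) \<inter> topspace X"
    by (rule avoiding_sheaf[OF x S, where P = P]) (rule that)
  have "sheaf_with_vertex X x (\<lambda>n l. g (prod_encode (n, l)))"
    unfolding sheaf_with_vertex_def
  proof
    fix n
    show "converging_sequence X (topspace X - {x}) (\<lambda>l. g (prod_encode (n, l))) x"
      by (rule converging_sequence_mono[OF g(2)]) (auto simp: A_def)
  qed
  then obtain L y where y: "y \<in> topspace X" and L: "converging_sequence X (topspace X) L y"
    and inf: "infinite {n. range L \<inter> range (\<lambda>l. g (prod_encode (n, l))) \<noteq> {}}"
    using assms(2) x unfolding alpha7_space_def by blast
  show False
  proof (cases "y = x")
    case True
    obtain Q where Q: "Q \<in> \<P>" "Q \<subseteq> U" "\<forall>\<^sub>F n in sequentially. L n \<in> Q"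
      using net[OF L[unfolded True] U] by blast
    obtain k where k: "PU k = Q" using surjU[OF Q(1,2)] ..
    obtain N where N: "\<And>n. n \<ge> N \<Longrightarrow> L n \<in> Q"
      using Q(3) unfolding eventually_sequentially by blast
    obtain j n l where jnl: "N \<le> j" "k \<le> n" "L j = g (prod_encode (n, l))"
      by (rule alpha7_frequently[OF g(1) inf, of N k])
    have "g (prod_encode (n, l)) \<in> A n"
      using g(2)[of n] unfolding converging_sequence_def by blast
    then have "L j \<notin> PU k" using jnl unfolding A_def by auto
    then show False using N[OF jnl(1)] k by simp
  next
    \<comment> \<open>The network at \<open>x\<close> is carried to \<open>y\<close> by
      \<open>f\<close>, so a tail of \<open>L\<close> lies in one small image of \<open>Q\<close>.
      Any two terms there are linked by \<open>translates_through\<close>, which the thinning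
      forbids.\<close>
    case False
    then have "x \<noteq> y" by simp
    obtain V where V: "openin X V" "x \<in> V"
      "\<And>Q f z. Q \<subseteq> V \<Longrightarrow> aut f \<Longrightarrow> f x = y \<Longrightarrow> z \<in> f ` Q \<Longrightarrow>
         x \<notin> X closure_of (translates_through z Q)"
      by (rule closure_of_translates_through[OF x y x \<open>x \<noteq> y\<close>]) (rule that)
    obtain f where f: "aut f" "f x = y" using transitive[OF x y] by blast
    obtain h where h: "aut h" "\<And>z. z \<in> topspace X \<Longrightarrow> h (f z) = z"
      "\<And>z. z \<in> topspace X \<Longrightarrow> f (h z) = z"
      by (rule aut_inverse[OF f(1)]) (rule that)
    have "converging_sequence X (topspace X) (h \<circ> L) x"
      using converging_sequence_continuous_map[OF aut_continuous[OF h(1)] L] h(2)[OF x] f(2) by simp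
    then obtain Q where Q: "Q \<in> \<P>" "Q \<subseteq> V" "\<forall>\<^sub>F n in sequentially. (h \<circ> L) n \<in> Q"
      using net[OF _ V(1,2)] by blast
    obtain k where k: "P k = Q" using surj[OF Q(1)] ..
    obtain N where N: "\<And>n. n \<ge> N \<Longrightarrow> (h \<circ> L) n \<in> Q"
      using Q(3) unfolding eventually_sequentially by blast
    have Ltop: "L n \<in> topspace X" for n
      using L unfolding converging_sequence_def by blast
    have LQ: "L n \<in> f ` Q" if "n \<ge> N" for n
      using N[OF that] h(3)[OF Ltop[of n]] by (metis comp_apply imageI)
    obtain i n l where 1: "N \<le> i" "L i = g (prod_encode (n, l))"
      by (rule alpha7_frequently[OF g(1) inf, of N 0])
    \<comment> \<open>The second code exceeds \<open>k\<close> and the first code, so its choice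
      already took \<open>L i\<close> and \<open>P k\<close> into account.\<close>
    obtain j n' l' where 2: "N \<le> j" "Suc (max k (prod_encode (n, l))) \<le> prod_encode (n', l')"
      "L j = g (prod_encode (n', l'))"
      by (rule alpha7_frequently[OF g(1) inf, of N "Suc (max k (prod_encode (n, l)))"])
    have "x \<notin> X closure_of (translates_through (L i) (P k))"
      using V(3)[OF Q(2) f LQ[OF 1(1)]] k by simp
    then have "L j \<notin> translates_through (L i) (P k) \<inter> topspace X"
      using g(3)[of "prod_encode (n, l)" "prod_encode (n', l')" k] 1 2 by auto
    moreover have "L j \<in> translates_through (L i) (P k)"
      using translates_through_I[OF f(1) LQ[OF 1(1)] LQ[OF 2(1)]] k by simp
    ultimately show False using Ltop by blast
  qed
qed

section \<open>Invariant relations and open neighborhoods in sequential spaces\<close>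

text \<open>The relation \<open>z \<in> y B\<close> of topological groups, made independent of the choice of the translation
  moving \<open>x\<close> to \<open>y\<close>.\<close>

definition translate_relation :: "'a \<Rightarrow> 'a set \<Rightarrow> 'a rel" where
  "translate_relation x B = {(f x, f z) |f z. aut f \<and> z \<in> B}"

lemma translate_relation_aut:
  assumes "aut g" "(y, z) \<in> translate_relation x B"
  shows "(g y, g z) \<in> translate_relation x B"
proof -
  obtain f w where "aut f" "w \<in> B" "y = f x" "z = f w"
    using assms(2) unfolding translate_relation_def by blast
  then have "aut (g \<circ> f)" "w \<in> B" "g y = (g \<circ> f) x" "g z = (g \<circ> f) w"
    using assms(1) entourage_automorphism_comp by auto
  then show ?thesis unfolding translate_relation_def by blast
qed

lemma translate_relation_subset_entourage:
  assumes "E \<in> \<D>" "B \<subseteq> E `` {x}"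
  shows "translate_relation x B \<subseteq> E"
  using assms aut_entourage unfolding translate_relation_def by auto

lemma translate_relation_subset:
  assumes "x \<in> topspace X" "B \<subseteq> topspace X"
  shows "translate_relation x B \<subseteq> topspace X \<times> topspace X"
  using assms aut_mem unfolding translate_relation_def by auto

text \<open>A single automorphism carrying \<open>x\<close> to \<open>y\<close> suffices: its
  inverse pulls a sequence tending to \<open>y\<close> back to one that is eventually in
  \<open>B\<close>.\<close>

lemma sequential_neighborhood_translate_relation:
  assumes x: "x \<in> topspace X" and y: "y \<in> topspace X" and B: "sequential_neighborhood X x B"
  shows "sequential_neighborhood X y (translate_relation x B `` {y})"
  unfolding sequential_neighborhood_def
proof (intro conjI allI impI)
  have sub: "B \<subseteq> topspace X" using B by (simp add: sequential_neighborhood_def)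
  show "translate_relation x B `` {y} \<subseteq> topspace X"
    using translate_relation_subset[OF x sub] by blast
  fix s assume s: "converging_sequence X (topspace X) s y"
  obtain f where f: "aut f" "f x = y" using transitive[OF x y] by blast
  obtain h where h: "aut h" "\<And>z. z \<in> topspace X \<Longrightarrow> h (f z) = z"
    "\<And>z. z \<in> topspace X \<Longrightarrow> f (h z) = z"
    by (rule aut_inverse[OF f(1)]) (rule that)
  have "converging_sequence X (topspace X) (h \<circ> s) x"
    using converging_sequence_continuous_map[OF aut_continuous[OF h(1)] s] h(2)[OF x] f(2) by simp
  then have "\<forall>\<^sub>F n in sequentially. (h \<circ> s) n \<in> B"
    using B unfolding sequential_neighborhood_def by blast
  then show "\<forall>\<^sub>F n in sequentially. s n \<in> translate_relation x B `` {y}"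
  proof (rule eventually_mono)
    fix n assume n: "(h \<circ> s) n \<in> B"
    have "s n \<in> topspace X" using s unfolding converging_sequence_def by blast
    then have "(y, s n) = (f x, f (h (s n)))" using f(2) h(3) by simp
    then show "s n \<in> translate_relation x B `` {y}"
      using f(1) n unfolding translate_relation_def by auto
  qed
qed

text \<open>The analogue of \<open>B k B k \<subseteq> B m\<close> for some \<open>k\<close>: otherwise there would be a sequence tending to
  \<open>x\<close> outside of the sequential neighborhood \<open>B m\<close>.\<close>

lemma translate_relation_half:
  fixes B :: "nat \<Rightarrow> 'a set"
  assumes x: "x \<in> topspace X" and B: "\<And>n. sequential_neighborhood X x (B n)" and "decseq B"
    and small: "\<And>U. openin X U \<Longrightarrow> x \<in> U \<Longrightarrow> \<exists>n. B n \<subseteq> U"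
  shows "\<exists>k. translate_relation x (B k) O translate_relation x (B k) \<subseteq> translate_relation x (B m)"
proof (rule ccontr)
  define R where "R n = translate_relation x (B n)" for n
  assume "\<not> ?thesis"
  then have bad: "\<not> R k O R k \<subseteq> R m" for k
    by (simp add: R_def)
  \<comment> \<open>Invariance moves the starting point of each bad pair to \<open>x\<close>, so
    that the endpoints form one sequence to be compared with \<open>x\<close>.\<close>
  have "\<exists>c. (x, c) \<in> R k O R k \<and> (x, c) \<notin> R m" for k
  proof -
    obtain a c where "(a, c) \<in> R k O R k" and ac: "(a, c) \<notin> R m"
      using bad[of k] by auto
    then obtain b where b: "(a, b) \<in> R k" "(b, c) \<in> R k" by blast
    have "B k \<subseteq> topspace X" using B by (simp add: sequential_neighborhood_def)
    then have top: "a \<in> topspace X" "c \<in> topspace X"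
      using translate_relation_subset[OF x] b unfolding R_def by blast+
    obtain f where f: "aut f" "f a = x" using transitive[OF top(1) x] by blast
    obtain h where h: "aut h" "\<And>z. z \<in> topspace X \<Longrightarrow> h (f z) = z"
      "\<And>z. z \<in> topspace X \<Longrightarrow> f (h z) = z"
      by (rule aut_inverse[OF f(1)]) (rule that)
    have "(x, f b) \<in> R k" "(f b, f c) \<in> R k"
      using translate_relation_aut[OF f(1)] b f(2) unfolding R_def by metis+
    moreover have "(x, f c) \<notin> R m"
    proof
      assume "(x, f c) \<in> R m"
      then have "(h x, h (f c)) \<in> R m"
        using translate_relation_aut[OF h(1)] unfolding R_def by blast
      then show False using ac h(2)[OF top(1)] h(2)[OF top(2)] f(2) by simp
    qed
    ultimately show ?thesis by blast
  qed
  then obtain c where c: "\<And>k. (x, c k) \<in> R k O R k" "\<And>k. (x, c k) \<notin> R m" by metis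
  have "R n \<subseteq> topspace X \<times> topspace X" for n
    using translate_relation_subset[OF x] B unfolding R_def sequential_neighborhood_def by blast
  then have "range c \<subseteq> topspace X" using c(1) by blast
  moreover have "\<exists>N. \<forall>k\<ge>N. c k \<in> U" if U: "openin X U" "x \<in> U" for U
  proof -
    obtain E where E: "E \<in> \<D>" "E `` {x} \<subseteq> U"
      using entourage_base[OF U] by blast
    obtain F where F: "F \<in> \<D>" "F O F \<subseteq> E"
      using entourage_half[OF E(1)] by blast
    have "x \<in> F `` {x}" using entourage_refl[OF F(1) x] by simp
    then obtain N where N: "B N \<subseteq> F `` {x}"
      using small[OF entourage_open[OF F(1) x]] by blast
    have "c k \<in> U" if "k \<ge> N" for k
    proof -
      have "B k \<subseteq> F `` {x}" using decseqD[OF assms(3) that] N by blast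
      then have "R k \<subseteq> F"
        unfolding R_def by (rule translate_relation_subset_entourage[OF F(1)])
      then have "(x, c k) \<in> E" using c(1)[of k] F(2) by blast
      then show ?thesis using E(2) by blast
    qed
    then show ?thesis by blast
  qed
  ultimately have "converging_sequence X (topspace X) c x"
    using x unfolding converging_sequence_def limitin_sequentially by blast
  \<comment> \<open>The set avoided by \<open>c\<close> is the image of \<open>x\<close> under
    \<open>R m\<close>, which may exceed \<open>B m\<close> by images under automorphisms fixing
    \<open>x\<close>.\<close>
  then have "\<forall>\<^sub>F k in sequentially. c k \<in> R m `` {x}"
    using sequential_neighborhood_translate_relation[OF x x B]
    unfolding sequential_neighborhood_def R_def by blast
  then obtain k where "c k \<in> R m `` {x}"
    using eventually_happens trivial_limit_sequentially by blast
  then show False using c(2) by blast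
qed

text \<open>With \<open>R (k (Suc j)) O R (k (Suc j)) \<subseteq> R (k j)\<close> for all \<open>j\<close>, the union of the sets reached from \<open>x\<close>
  by the compositions \<open>R (k 1) O \<dots> O R (k j)\<close> is open in a sequential space and contained in
  \<open>R (k 0) `` {x}\<close>.\<close>

lemma translate_relation_open_subset:
  fixes B :: "nat \<Rightarrow> 'a set"
  assumes x: "x \<in> topspace X" and B: "\<And>n. sequential_neighborhood X x (B n)" and "decseq B"
    and small: "\<And>U. openin X U \<Longrightarrow> x \<in> U \<Longrightarrow> \<exists>n. B n \<subseteq> U"
    and "sequential_space X"
  shows "\<exists>W. openin X W \<and> x \<in> W \<and> W \<subseteq> translate_relation x (B m) `` {x}"
proof -
  define R where "R n = translate_relation x (B n)" for n
  have nbhd: "sequential_neighborhood X y (R n `` {y})" if "y \<in> topspace X" for y n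
    unfolding R_def by (rule sequential_neighborhood_translate_relation[OF x that B])
  have refl: "(y, y) \<in> R n" if "y \<in> topspace X" for y n
    using sequential_neighborhood_mem[OF nbhd[OF that] that] by blast
  have "\<exists>k. R k O R k \<subseteq> R n" for n
    unfolding R_def using translate_relation_half[OF x B assms(3) small] .
  then obtain half where half: "\<And>n. R (half n) O R (half n) \<subseteq> R n" by metis
  define k where "k j = (half ^^ j) m" for j
  define C where "C = rec_nat {x} (\<lambda>j D. R (k (Suc j)) `` D)"
  have C0: "C 0 = {x}" and CSuc: "C (Suc j) = R (k (Suc j)) `` C j" for j
    by (simp_all add: C_def)
  have step: "(x, z) \<in> R m" if "y \<in> C j" "(y, z) \<in> R (k j)" for y z j
    using that
  proof (induction j arbitrary: y z)
    case 0
    then show ?case by (simp add: C0 k_def)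
  next
    case (Suc j)
    then obtain w where w: "w \<in> C j" "(w, y) \<in> R (k (Suc j))" by (auto simp: CSuc)
    then have "(w, z) \<in> R (k j)"
      using half[of "k j"] Suc.prems(2) by (auto simp: k_def)
    then show ?case by (rule Suc.IH[OF w(1)])
  qed
  have top: "C j \<subseteq> topspace X" for j
  proof (induction j)
    case 0
    then show ?case using x by (simp add: C0)
  next
    case (Suc j)
    then show ?case
      using nbhd unfolding CSuc sequential_neighborhood_def by blast
  qed
  have "openin X (\<Union>j. C j)"
  proof (rule openin_sequential_space[OF assms(5)])
    show "(\<Union>j. C j) \<subseteq> topspace X" using top by blast
    fix y assume "y \<in> (\<Union>j. C j)"
    then obtain j where j: "y \<in> C j" by blast
    then have "R (k (Suc j)) `` {y} \<subseteq> C (Suc j)" unfolding CSuc by blast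
    then show "\<exists>B. sequential_neighborhood X y B \<and> B \<subseteq> (\<Union>j. C j)"
      using nbhd[of y] top j by (meson UN_upper UNIV_I order_trans subsetD)
  qed
  moreover have "x \<in> (\<Union>j. C j)" using C0 by blast
  moreover have "(\<Union>j. C j) \<subseteq> R m `` {x}"
    using step refl top by blast
  ultimately show ?thesis unfolding R_def by blast
qed

text \<open>The open sets \<open>W n\<close> need not lie in \<open>B n\<close>, only in the set of
  its translates through \<open>x\<close>; an entourage whose ball around \<open>x\<close> contains
  \<open>B n\<close> controls these as well.\<close>

lemma csf_sequential_alpha7_imp_first_countable:
  assumes "csf_countable X" "sequential_space X" "alpha7_space X"
  shows "first_countable X"
  unfolding first_countable_def
proof
  fix x assume x: "x \<in> topspace X"
  obtain \<P> where \<P>: "countable \<P>" "cs_network_at X x \<P>"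
    using assms(1) x unfolding csf_countable_def by blast
  let ?\<S> = "{\<Union>\<F> |\<F>. finite \<F> \<and> \<F> \<subseteq> \<P> \<and> sequential_neighborhood X x (\<Union>\<F>)}"
  have fine: "\<exists>B\<in>?\<S>. B \<subseteq> U" if U: "openin X U" "x \<in> U" for U
  proof -
    obtain \<F> where "finite \<F> \<and> \<F> \<subseteq> \<P> \<and> \<Union>\<F> \<subseteq> U \<and> sequential_neighborhood X x (\<Union>\<F>)"
      using csf_alpha7_sequential_neighborhood[OF x assms(3) \<P> U] ..
    then show ?thesis by (intro bexI[of _ "\<Union>\<F>"]) auto
  qed
  have "?\<S> \<subseteq> Union ` {\<F>. finite \<F> \<and> \<F> \<subseteq> \<P>}" by blast
  then have "countable ?\<S>"
    by (rule countable_subset) (rule countable_image[OF countable_Collect_finite_subset[OF \<P>(1)]])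
  moreover have "?\<S> \<noteq> {}" using fine[of "topspace X"] x by auto
  ultimately obtain B :: "nat \<Rightarrow> 'a set" where B: "decseq B"
    "\<And>n. \<exists>\<F>. finite \<F> \<and> \<F> \<noteq> {} \<and> \<F> \<subseteq> ?\<S> \<and> B n = \<Inter>\<F>"
    "\<And>S. S \<in> ?\<S> \<Longrightarrow> \<exists>n. B n \<subseteq> S"
    by (rule countable_decreasing_intersections) (rule that)
  have nbhd: "sequential_neighborhood X x (B n)" for n
  proof -
    obtain \<F> where F: "finite \<F>" "\<F> \<noteq> {}" "\<F> \<subseteq> ?\<S>" "B n = \<Inter>\<F>"
      using B(2)[of n] by (elim exE conjE) (rule that)
    have "sequential_neighborhood X x (\<Inter>\<F>)"
      by (rule sequential_neighborhood_Inter[OF F(1,2)]) (use F(3) in auto)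
    then show ?thesis using F(4) by simp
  qed
  have small: "\<exists>n. B n \<subseteq> U" if U: "openin X U" "x \<in> U" for U
  proof -
    obtain S where S: "S \<in> ?\<S>" "S \<subseteq> U" using fine[OF U] by (elim bexE) (rule that)
    obtain n where "B n \<subseteq> S" using B(3)[OF S(1)] by (elim exE) (rule that)
    then have "B n \<subseteq> U" using S(2) by simp
    then show ?thesis ..
  qed
  have "\<exists>W. openin X W \<and> x \<in> W \<and> W \<subseteq> translate_relation x (B n) `` {x}" for n
    by (rule translate_relation_open_subset[OF x nbhd B(1) small assms(2)])
  then obtain W where W: "\<And>n. openin X (W n) \<and> x \<in> W n \<and> W n \<subseteq> translate_relation x (B n) `` {x}"
    by metis
  have "\<exists>n. W n \<subseteq> U" if U: "openin X U" "x \<in> U" for U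
  proof -
    obtain E where E: "E \<in> \<D>" "E `` {x} \<subseteq> U"
      using entourage_base[OF U] by blast
    have "x \<in> E `` {x}" using entourage_refl[OF E(1) x] by simp
    then obtain n where "B n \<subseteq> E `` {x}"
      using small[OF entourage_open[OF E(1) x]] by blast
    then have "translate_relation x (B n) \<subseteq> E"
      by (rule translate_relation_subset_entourage[OF E(1)])
    then show ?thesis using W[of n] E(2) by blast
  qed
  then show "\<exists>\<B>. countable \<B> \<and> (\<forall>V\<in>\<B>. openin X V) \<and>
      (\<forall>U. openin X U \<and> x \<in> U \<longrightarrow> (\<exists>V\<in>\<B>. x \<in> V \<and> V \<subseteq> U))"
    using W by (intro exI[of _ "range W"]) auto
qed

lemma first_countable_iff_bisequential: "first_countable X \<longleftrightarrow> bisequential X"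
  by (rule iffI[OF first_countable_imp_bisequential bisequential_imp_first_countable])

lemma first_countable_iff_csf_sequential_alpha7:
  "first_countable X \<longleftrightarrow> csf_countable X \<and> sequential_space X \<and> alpha7_space X"
proof
  assume "first_countable X"
  then show "csf_countable X \<and> sequential_space X \<and> alpha7_space X"
    by (intro weakly_first_countable_imp_csf_sequential_alpha7[OF Hausdorff]
        first_countable_imp_weakly_first_countable)
qed (elim conjE, rule csf_sequential_alpha7_imp_first_countable)

text \<open>The way back to first countability leads through the csf-countable, sequential, alpha_7
  characterization.\<close>

lemma first_countable_iff_weakly_first_countable: "first_countable X \<longleftrightarrow> weakly_first_countable X"
proof
  assume "weakly_first_countable X"
  then show "first_countable X"
    unfolding first_countable_iff_csf_sequential_alpha7
    by (rule weakly_first_countable_imp_csf_sequential_alpha7[OF Hausdorff])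
qed (rule first_countable_imp_weakly_first_countable)

end

section \<open>Coset spaces of gyrogroups\<close>

context gyrogroup
begin

lemma gyr_bij: "x \<in> G \<Longrightarrow> y \<in> G \<Longrightarrow> bij_betw (gyr x y) G G"
  using gyr_automorphism by (simp add: gyro_automorphism_def)

lemma gyr_mem: "x \<in> G \<Longrightarrow> y \<in> G \<Longrightarrow> z \<in> G \<Longrightarrow> gyr x y z \<in> G"
  by (rule bij_betw_apply[OF gyr_bij])

lemma gyr_inj: "x \<in> G \<Longrightarrow> y \<in> G \<Longrightarrow> inj_on (gyr x y) G"
  by (rule bij_betw_imp_inj_on[OF gyr_bij])

text \<open>Adding \<open>neg a\<close> on the left turns \<open>add a z\<close> into
  \<open>gyr (neg a) a z\<close>, and gyrations are injective.\<close>

lemma add_left_imp_eq: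
  assumes "a \<in> G" "b \<in> G" "c \<in> G" "add a b = add a c"
  shows "b = c"
proof -
  have "add (neg a) (add a z) = gyr (neg a) a z" if "z \<in> G" for z
    using gyr_assoc[OF neg_closed[OF assms(1)] assms(1) that] neg_inverse[OF assms(1)] zero_neutral
      gyr_mem[OF neg_closed[OF assms(1)] assms(1) that] by simp
  then have "gyr (neg a) a b = gyr (neg a) a c"
    using assms by metis
  then show ?thesis
    using gyr_inj[OF neg_closed[OF assms(1)] assms(1)] assms(2,3) by (simp add: inj_on_eq_iff)
qed

text \<open>The loop property identifies \<open>gyr (neg a) a\<close> with
  \<open>gyr zero a\<close>, which left cancellation shows to be the identity.\<close>

lemma neg_add_cancel:
  assumes "a \<in> G" "b \<in> G"
  shows "add (neg a) (add a b) = b"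
proof -
  have "add a b = add a (gyr zero a b)"
    using gyr_assoc[OF zero_closed assms] zero_neutral assms add_closed by simp
  then have "gyr zero a b = b"
    using add_left_imp_eq assms gyr_mem zero_closed by metis
  then have "gyr (neg a) a b = b"
    using gyr_loop[OF neg_closed[OF assms(1)] assms] neg_inverse[OF assms(1)] by simp
  then show ?thesis
    using gyr_assoc[OF neg_closed[OF assms(1)] assms] neg_inverse[OF assms(1)] zero_neutral assms by simp
qed

lemma add_neg_cancel:
  assumes "a \<in> G" "b \<in> G"
  shows "add a (add (neg a) b) = b"
proof -
  have "a = neg (neg a)"
    using neg_unique[OF neg_closed[OF assms(1)] assms(1)] neg_inverse[OF assms(1)] by blast
  then show ?thesis using neg_add_cancel[OF neg_closed[OF assms(1)] assms(2)] by simp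
qed

lemma gyr_eq:
  assumes "x \<in> G" "y \<in> G" "z \<in> G"
  shows "gyr x y z = add (neg (add x y)) (add x (add y z))"
  using gyr_assoc[OF assms] neg_add_cancel[of "add x y" "gyr x y z"] assms add_closed gyr_mem by simp

end

lemma left_coset_iff: "z \<in> left_coset add H a \<longleftrightarrow> (\<exists>h\<in>H. z = add a h)"
  by (auto simp: left_coset_def set_add_def)

section \<open>Translations, gyrations and invariant neighborhoods\<close>

context topological_gyrogroup
begin

lemma continuous_add_left: "a \<in> topspace T \<Longrightarrow> continuous_map T T (add a)"
  using continuous_map_compose[OF _ continuous_add, of T "\<lambda>z. (a, z)"]
  by (simp add: continuous_map_pairwise comp_def)

lemma continuous_add_right: "a \<in> topspace T \<Longrightarrow> continuous_map T T (\<lambda>z. add z a)"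
  using continuous_map_compose[OF _ continuous_add, of T "\<lambda>z. (z, a)"]
  by (simp add: continuous_map_pairwise comp_def)

lemma openin_add_image:
  assumes "a \<in> topspace T" "openin T W"
  shows "openin T (add a ` W)"
proof -
  have "W \<subseteq> topspace T" using assms(2) by (rule openin_subset)
  then have "add a ` W = {z \<in> topspace T. add (neg a) z \<in> W}"
    using neg_add_cancel[OF assms(1)] add_neg_cancel[OF assms(1)] add_closed[OF assms(1)]
    by (auto simp: image_iff) (metis subsetD)+
  then show ?thesis
    using openin_continuous_map_preimage[OF continuous_add_left[OF neg_closed[OF assms(1)]] assms(2)]
    by simp
qed

text \<open>By \<open>gyr_eq\<close> a gyration is a composite of three left translations, each of
  them an open map.\<close>

lemma openin_gyr_image:
  assumes "x \<in> topspace T" "y \<in> topspace T" "openin T W"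
  shows "openin T (gyr x y ` W)"
proof -
  have "gyr x y ` W = add (neg (add x y)) ` add x ` add y ` W"
    using gyr_eq[OF assms(1,2)] openin_subset[OF assms(3)] by (force simp: image_iff)
  then show ?thesis
    using assms add_closed neg_closed openin_add_image by simp
qed

lemma add_neighborhood:
  assumes "openin T W" "zero \<in> W"
  obtains U where "openin T U" "zero \<in> U" "\<And>u v. u \<in> U \<Longrightarrow> v \<in> U \<Longrightarrow> add u v \<in> W"
    "\<And>u v. u \<in> U \<Longrightarrow> v \<in> U \<Longrightarrow> add (neg u) v \<in> W"
proof -
  have nz: "add (neg zero) zero = zero" and zz: "add zero zero = zero"
    using neg_inverse[OF zero_closed] zero_neutral[OF zero_closed] by simp_all
  have "continuous_map (prod_topology T T) T (\<lambda>p. neg (fst p))"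
    using continuous_map_compose[OF continuous_map_fst continuous_neg, of T] by (simp add: comp_def)
  then have "continuous_map (prod_topology T T) (prod_topology T T) (\<lambda>p. (neg (fst p), snd p))"
    using continuous_map_snd[of T T] by (simp add: continuous_map_pairwise comp_def)
  from continuous_map_compose[OF this continuous_add]
  have "continuous_map (prod_topology T T) T (\<lambda>p. add (neg (fst p)) (snd p))"
    by (simp add: comp_def)
  then have 1: "openin (prod_topology T T)
      {p \<in> topspace (prod_topology T T). add (neg (fst p)) (snd p) \<in> W}"
    by (rule openin_continuous_map_preimage[OF _ assms(1)])
  have 2: "openin (prod_topology T T) {p \<in> topspace (prod_topology T T). add (fst p) (snd p) \<in> W}"
    using openin_continuous_map_preimage[OF continuous_add assms(1)] by (simp add: case_prod_unfold)
  have z: "(zero, zero) \<in> {p \<in> topspace (prod_topology T T). add (neg (fst p)) (snd p) \<in> W}"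
    "(zero, zero) \<in> {p \<in> topspace (prod_topology T T). add (fst p) (snd p) \<in> W}"
    using nz zz assms(2) zero_closed by auto
  obtain A B where AB: "openin T A" "openin T B" "zero \<in> A" "zero \<in> B"
    "A \<times> B \<subseteq> {p \<in> topspace (prod_topology T T). add (neg (fst p)) (snd p) \<in> W}"
    using 1[unfolded openin_prod_topology_alt, rule_format, OF z(1)] by (elim exE conjE) (rule that)
  obtain C D where CD: "openin T C" "openin T D" "zero \<in> C" "zero \<in> D"
    "C \<times> D \<subseteq> {p \<in> topspace (prod_topology T T). add (fst p) (snd p) \<in> W}"
    using 2[unfolded openin_prod_topology_alt, rule_format, OF z(2)] by (elim exE conjE) (rule that)
  show thesis
  proof (rule that[of "A \<inter> B \<inter> (C \<inter> D)"])
    show "openin T (A \<inter> B \<inter> (C \<inter> D))" "zero \<in> A \<inter> B \<inter> (C \<inter> D)"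
      using AB CD by auto
    fix u v assume "u \<in> A \<inter> B \<inter> (C \<inter> D)" "v \<in> A \<inter> B \<inter> (C \<inter> D)"
    then have "(u, v) \<in> A \<times> B" "(u, v) \<in> C \<times> D" by auto
    then show "add u v \<in> W" "add (neg u) v \<in> W"
      using subsetD[OF AB(5)] subsetD[OF CD(5)] by fastforce+
  qed
qed

end

context strongly_topological_gyrogroup
begin

definition gyr_neighborhood :: "'a set \<Rightarrow> bool" where
  "gyr_neighborhood U \<longleftrightarrow> openin T U \<and> zero \<in> U \<and>
     (\<forall>x\<in>topspace T. \<forall>y\<in>topspace T. \<forall>z\<in>U. gyr x y z \<in> U)"

text \<open>A member of the invariant base need not be open, but its interior inherits the
  invariance: a gyration maps the interior to an open subset of that member.\<close>

lemma gyr_neighborhood_exists: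
  assumes "openin T W" "zero \<in> W"
  obtains U where "gyr_neighborhood U" "U \<subseteq> W"
proof -
  have W: "neighborhood_in T zero W"
    using assms openin_subset unfolding neighborhood_in_def by blast
  obtain \<U> where \<U>: "\<forall>U\<in>\<U>. neighborhood_in T zero U"
    "\<forall>W. neighborhood_in T zero W \<longrightarrow> (\<exists>U\<in>\<U>. U \<subseteq> W)"
    "\<forall>U\<in>\<U>. \<forall>x\<in>topspace T. \<forall>y\<in>topspace T. gyr x y ` U = U"
    using invariant_base by (elim exE conjE) (rule that)
  obtain B where "B \<in> \<U>" "B \<subseteq> W"
    using \<U>(2)[rule_format, OF W] by (elim bexE) (rule that)
  then have B: "neighborhood_in T zero B" "B \<subseteq> W"
    "\<And>x y. x \<in> topspace T \<Longrightarrow> y \<in> topspace T \<Longrightarrow> gyr x y ` B = B"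
    using \<U>(1,3) by simp_all
  define U where "U = T interior_of B"
  have UB: "U \<subseteq> B" "openin T U" unfolding U_def by (auto simp: interior_of_subset)
  have "zero \<in> U"
    using B(1) unfolding neighborhood_in_def U_def interior_of_def by blast
  moreover have "gyr x y z \<in> U" if xy: "x \<in> topspace T" "y \<in> topspace T" and z: "z \<in> U" for x y z
  proof -
    have "gyr x y ` U \<subseteq> B" using image_mono[OF UB(1), of "gyr x y"] B(3)[OF xy] by simp
    then have "gyr x y ` U \<subseteq> U"
      unfolding U_def using openin_gyr_image[OF xy UB(2)] by (simp add: interior_of_maximal U_def)
    then show ?thesis using z by blast
  qed
  ultimately have "gyr_neighborhood U"
    using UB(2) unfolding gyr_neighborhood_def by blast
  then show thesis using that UB(1) B(2) by blast
qed

end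

locale inner_neutral_coset_space = strongly_topological_gyrogroup +
  fixes H :: "'a set"
  assumes strong_sub: "strong_subgyrogroup (topspace T) add gyr H"
    and closed_sub: "closedin T H"
    and neutral: "inner_neutral T add zero H"
begin

abbreviation "\<pi> \<equiv> left_coset add H"
abbreviation "X \<equiv> coset_space T add H"

section \<open>Left cosets and the action of translations\<close>

lemma sub_mem: "h \<in> H \<Longrightarrow> h \<in> topspace T"
  using strong_sub by (auto simp: strong_subgyrogroup_def subgyrogroup_def)

lemma sub_gyr: "x \<in> topspace T \<Longrightarrow> y \<in> topspace T \<Longrightarrow> gyr x y ` H = H"
  using strong_sub by (simp add: strong_subgyrogroup_def)

text \<open>A subgyrogroup brings its own neutral element and inverses; left cancellation in the
  ambient gyrogroup identifies them with \<open>zero\<close> and \<open>neg\<close>.\<close>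

lemma sub_add: "h \<in> H \<Longrightarrow> k \<in> H \<Longrightarrow> add h k \<in> H"
  and sub_zero: "zero \<in> H"
  and sub_neg: "h \<in> H \<Longrightarrow> neg h \<in> H"
proof -
  obtain zero' neg' gyr' where "gyrogroup H add zero' neg' gyr'"
    using strong_sub by (auto simp: strong_subgyrogroup_def subgyrogroup_def)
  then interpret S: gyrogroup H add zero' neg' gyr' .
  have "add zero' zero' = add zero' zero"
    using S.zero_neutral[OF S.zero_closed] zero_neutral[OF sub_mem[OF S.zero_closed]] by simp
  then have "zero' = zero"
    by (rule add_left_imp_eq[OF sub_mem sub_mem zero_closed, OF S.zero_closed S.zero_closed])
  then show "zero \<in> H" using S.zero_closed by simp
  show "add h k \<in> H" if "h \<in> H" "k \<in> H" for k
    using that by (rule S.add_closed)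
  assume h: "h \<in> H"
  have "add h (neg' h) = add h (neg h)"
    using S.neg_inverse[OF h] neg_inverse[OF sub_mem[OF h]] \<open>zero' = zero\<close> by simp
  then have "neg' h = neg h"
    by (rule add_left_imp_eq[OF sub_mem sub_mem neg_closed[OF sub_mem], OF h S.neg_closed h, OF h])
  then show "neg h \<in> H" using S.neg_closed[OF h] by simp
qed

lemma coset_self: "a \<in> topspace T \<Longrightarrow> a \<in> \<pi> a"
  unfolding left_coset_iff by (rule bexI[OF _ sub_zero]) (simp add: zero_neutral)

text \<open>Reassociating introduces \<open>gyr g a\<close>, which maps \<open>H\<close> onto itself
  because \<open>H\<close> is strong; hence translations act on cosets.\<close>

lemma coset_translate:
  assumes "g \<in> topspace T" "a \<in> topspace T"
  shows "add g ` \<pi> a = \<pi> (add g a)"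
proof -
  have "add g ` \<pi> a = (\<lambda>h. add g (add a h)) ` H"
    unfolding left_coset_def set_add_def by blast
  also have "\<dots> = (\<lambda>h. add (add g a) (gyr g a h)) ` H"
    using gyr_assoc[OF assms sub_mem] by auto
  also have "\<dots> = add (add g a) ` (gyr g a ` H)" by auto
  also have "\<dots> = \<pi> (add g a)"
    unfolding sub_gyr[OF assms] left_coset_def set_add_def by blast
  finally show ?thesis .
qed

lemma coset_zero: "\<pi> zero = H"
  by (auto simp: left_coset_iff zero_neutral sub_mem)

lemma coset_sub: "h \<in> H \<Longrightarrow> \<pi> h = H"
proof
  assume h: "h \<in> H"
  show "\<pi> h \<subseteq> H" using sub_add h by (auto simp: left_coset_iff)
  show "H \<subseteq> \<pi> h"
  proof
    fix k assume "k \<in> H"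
    then show "k \<in> \<pi> h"
      using add_neg_cancel[OF sub_mem[OF h] sub_mem] sub_add[OF sub_neg[OF h]]
      unfolding left_coset_iff by metis
  qed
qed

lemma coset_add_sub:
  assumes "a \<in> topspace T" "h \<in> H"
  shows "\<pi> (add a h) = \<pi> a"
proof -
  have "\<pi> (add a h) = add a ` \<pi> zero"
    using coset_translate[OF assms(1) sub_mem[OF assms(2)]] coset_sub[OF assms(2)] coset_zero by simp
  also have "\<dots> = \<pi> a"
    using coset_translate[OF assms(1) zero_closed] zero_neutral assms(1) by simp
  finally show ?thesis .
qed

lemma coset_eq_iff:
  assumes "a \<in> topspace T" "b \<in> topspace T"
  shows "\<pi> a = \<pi> b \<longleftrightarrow> b \<in> \<pi> a"
proof
  show "b \<in> \<pi> a" if "\<pi> a = \<pi> b"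
    using coset_self[OF assms(2)] that by simp
  show "\<pi> a = \<pi> b" if "b \<in> \<pi> a"
    using coset_add_sub[OF assms(1)] that by (auto simp: left_coset_iff)
qed

text \<open>The saturation of \<open>W\<close> is the union over \<open>h \<in> H\<close> of the
  preimages of \<open>W\<close> under right addition of \<open>h\<close>.\<close>

lemma openin_coset_image:
  assumes "openin T W"
  shows "openin X (\<pi> ` W)"
  unfolding openin_coset_space
proof
  have W: "W \<subseteq> topspace T" using assms by (rule openin_subset)
  then show "\<pi> ` W \<subseteq> \<pi> ` topspace T" by blast
  have "{a \<in> topspace T. \<pi> a \<in> \<pi> ` W} = (\<Union>h\<in>H. {a \<in> topspace T. add a h \<in> W})"
  proof (intro equalityI subsetI)
    fix a assume "a \<in> {a \<in> topspace T. \<pi> a \<in> \<pi> ` W}"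
    then obtain w where w: "a \<in> topspace T" "w \<in> W" "\<pi> a = \<pi> w" by auto
    then have "w \<in> \<pi> a" using coset_eq_iff W by auto
    then show "a \<in> (\<Union>h\<in>H. {a \<in> topspace T. add a h \<in> W})"
      using w unfolding left_coset_iff by auto
  next
    fix a assume "a \<in> (\<Union>h\<in>H. {a \<in> topspace T. add a h \<in> W})"
    then obtain h where h: "h \<in> H" "a \<in> topspace T" "add a h \<in> W" by auto
    then have "\<pi> a = \<pi> (add a h)" using coset_add_sub by simp
    then show "a \<in> {a \<in> topspace T. \<pi> a \<in> \<pi> ` W}" using h by auto
  qed
  moreover have "openin T {a \<in> topspace T. add a h \<in> W}" if "h \<in> H" for h
    using openin_continuous_map_preimage[OF continuous_add_right[OF sub_mem[OF that]] assms] .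
  ultimately show "openin T {a \<in> topspace T. \<pi> a \<in> \<pi> ` W}" by auto
qed

text \<open>The coset of \<open>a\<close> is the preimage of the closed set \<open>H\<close> under
  left translation by \<open>neg a\<close>.\<close>

lemma t1_coset_space: "t1_space X"
  unfolding t1_space_closedin_singleton
proof
  fix p assume "p \<in> topspace X"
  then obtain a where a: "a \<in> topspace T" "p = \<pi> a" by (auto simp: topspace_coset_space)
  have "{b \<in> topspace T. \<pi> b \<in> topspace X - {p}} =
      topspace T - {b \<in> topspace T. add (neg a) b \<in> H}"
  proof -
    have "\<pi> b = \<pi> a \<longleftrightarrow> add (neg a) b \<in> H" if b: "b \<in> topspace T" for b
    proof -
      have "\<pi> b = \<pi> a \<longleftrightarrow> b \<in> \<pi> a" using coset_eq_iff[OF a(1) b] by auto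
      also have "\<dots> \<longleftrightarrow> add (neg a) b \<in> H"
        using add_neg_cancel[OF a(1) b] neg_add_cancel[OF a(1) sub_mem]
        unfolding left_coset_iff by metis
      finally show ?thesis .
    qed
    then show ?thesis using a(2) by (auto simp: topspace_coset_space)
  qed
  moreover have "closedin T {b \<in> topspace T. add (neg a) b \<in> H}"
    using closedin_continuous_map_preimage[OF continuous_add_left[OF neg_closed[OF a(1)]] closed_sub] .
  ultimately have "openin X (topspace X - {p})"
    unfolding openin_coset_space by (auto simp: topspace_coset_space)
  then show "closedin X {p}"
    using \<open>p \<in> topspace X\<close> by (simp add: closedin_def)
qed

lemma translation_closed:
  assumes "g \<in> topspace T" "p \<in> topspace X"
  shows "add g ` p \<in> topspace X"
proof -
  obtain a where "a \<in> topspace T" "p = \<pi> a"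
    using assms(2) by (auto simp: topspace_coset_space)
  then show ?thesis
    using coset_translate[OF assms(1)] add_closed[OF assms(1)] by (simp add: topspace_coset_space)
qed

lemma translation_cancel:
  assumes "g \<in> topspace T" "p \<in> topspace X"
  shows "add (neg g) ` (add g ` p) = p" "add g ` (add (neg g) ` p) = p"
proof -
  obtain a where a: "a \<in> topspace T" "p = \<pi> a"
    using assms(2) by (auto simp: topspace_coset_space)
  then show "add (neg g) ` (add g ` p) = p" "add g ` (add (neg g) ` p) = p"
    using assms(1) by (simp_all add: coset_translate add_closed neg_closed neg_add_cancel add_neg_cancel)
qed

lemma continuous_translation:
  assumes "g \<in> topspace T"
  shows "continuous_map X X ((`) (add g))"
proof (rule continuous_compose_quotient_map[OF quotient_map_left_coset])
  have "continuous_map T X (\<pi> \<circ> add g)"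
    using continuous_map_compose[OF continuous_add_left[OF assms]
        quotient_imp_continuous_map[OF quotient_map_left_coset]] .
  then show "continuous_map T X ((`) (add g) \<circ> \<pi>)"
    by (rule continuous_map_eq) (simp add: coset_translate[OF assms])
qed

lemma homeomorphic_translation:
  assumes "g \<in> topspace T"
  shows "homeomorphic_map X X ((`) (add g))"
proof -
  have "homeomorphic_maps X X ((`) (add g)) ((`) (add (neg g)))"
    using continuous_translation translation_cancel[OF assms] assms neg_closed
    by (simp add: homeomorphic_maps_def)
  then show ?thesis by (auto simp: homeomorphic_map_maps)
qed

section \<open>The invariant uniformity on the coset space\<close>

text \<open>Defined by common translates, this relation is symmetric and translation invariant without any
  appeal to inner neutrality, which is needed only for the compatibility with the topology.\<close>

definition coset_entourage :: "'a set \<Rightarrow> 'a set rel" where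
  "coset_entourage U =
     {(\<pi> (add g u), \<pi> (add g v)) |g u v. g \<in> topspace T \<and> u \<in> U \<and> v \<in> U}"

lemma coset_entourage_mono: "U \<subseteq> V \<Longrightarrow> coset_entourage U \<subseteq> coset_entourage V"
  unfolding coset_entourage_def by blast

lemma gyr_neighborhood_subset: "gyr_neighborhood U \<Longrightarrow> U \<subseteq> topspace T"
  unfolding gyr_neighborhood_def using openin_subset by blast

lemma coset_entourage_subset:
  assumes "gyr_neighborhood U"
  shows "coset_entourage U \<subseteq> topspace X \<times> topspace X"
  using gyr_neighborhood_subset[OF assms] add_closed
  unfolding coset_entourage_def topspace_coset_space by blast

text \<open>Composing the translations by \<open>h\<close> and \<open>g\<close> leaves the error
  \<open>gyr h g\<close>, which the invariance of \<open>U\<close> absorbs.\<close>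

lemma coset_entourage_translate:
  assumes U: "gyr_neighborhood U" and h: "h \<in> topspace T" and pq: "(p, q) \<in> coset_entourage U"
  shows "(add h ` p, add h ` q) \<in> coset_entourage U"
proof -
  obtain g u v where g: "g \<in> topspace T" "u \<in> U" "v \<in> U" "p = \<pi> (add g u)" "q = \<pi> (add g v)"
    using pq unfolding coset_entourage_def by blast
  have translate: "add h ` \<pi> (add g w) = \<pi> (add (add h g) (gyr h g w))" if "w \<in> U" for w
  proof -
    have w: "w \<in> topspace T" using that gyr_neighborhood_subset[OF U] by blast
    show ?thesis
      using coset_translate[OF h add_closed[OF g(1) w]] gyr_assoc[OF h g(1) w] by simp
  qed
  have "gyr h g u \<in> U" "gyr h g v \<in> U"
    using U h g(1-3) unfolding gyr_neighborhood_def by blast+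
  then show ?thesis
    using translate[OF g(2)] translate[OF g(3)] g(4,5) add_closed[OF h g(1)]
    unfolding coset_entourage_def by blast
qed

lemma coset_entourage_translate_iff:
  assumes "gyr_neighborhood U" "h \<in> topspace T" "p \<in> topspace X" "q \<in> topspace X"
  shows "(add h ` p, add h ` q) \<in> coset_entourage U \<longleftrightarrow> (p, q) \<in> coset_entourage U"
proof
  assume "(add h ` p, add h ` q) \<in> coset_entourage U"
  from coset_entourage_translate[OF assms(1) neg_closed[OF assms(2)] this]
  show "(p, q) \<in> coset_entourage U"
    by (simp only: translation_cancel(1)[OF assms(2)] assms(3,4))
qed (rule coset_entourage_translate[OF assms(1,2)])

text \<open>If \<open>g \<oplus> u = h \<in> H\<close>, then \<open>g \<oplus> v = g \<oplus> (u \<oplus> (\<ominus>u \<oplus> v)) = h \<oplus> gyr[g, u](\<ominus>u \<oplus> v)\<close>, to which inner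
  neutrality applies.\<close>

lemma coset_entourage_zero:
  assumes W: "openin T W" "zero \<in> W"
  obtains U where "gyr_neighborhood U" "\<And>q. (\<pi> zero, q) \<in> coset_entourage U \<Longrightarrow> q \<in> \<pi> ` W"
proof -
  obtain V where V: "openin T V" "zero \<in> V" "set_add add H V \<subseteq> set_add add W H"
    using neutral W unfolding inner_neutral_def by blast
  obtain V' where V': "gyr_neighborhood V'" "V' \<subseteq> V"
    by (rule gyr_neighborhood_exists[OF V(1,2)])
  then have "openin T V'" "zero \<in> V'" by (auto simp: gyr_neighborhood_def)
  then obtain A where A: "openin T A" "zero \<in> A"
    "\<And>u v. u \<in> A \<Longrightarrow> v \<in> A \<Longrightarrow> add (neg u) v \<in> V'"
    by (rule add_neighborhood) (rule that)
  obtain U where U: "gyr_neighborhood U" "U \<subseteq> A"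
    by (rule gyr_neighborhood_exists[OF A(1,2)])
  have "q \<in> \<pi> ` W" if q: "(\<pi> zero, q) \<in> coset_entourage U" for q
  proof -
    obtain g u v where g: "g \<in> topspace T" "u \<in> U" "v \<in> U" "\<pi> zero = \<pi> (add g u)" "q = \<pi> (add g v)"
      using q unfolding coset_entourage_def by blast
    have uv: "u \<in> topspace T" "v \<in> topspace T"
      using g(2,3) gyr_neighborhood_subset[OF U(1)] by blast+
    have h: "add g u \<in> H"
      using coset_self[OF add_closed[OF g(1) uv(1)]] g(4) coset_zero by simp
    have "add (neg u) v \<in> V'" using A(3) g(2,3) U(2) by blast
    then have t: "gyr g u (add (neg u) v) \<in> V"
      using V' g(1) uv(1) unfolding gyr_neighborhood_def by blast
    have "add g v = add (add g u) (gyr g u (add (neg u) v))"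
      using gyr_assoc[OF g(1) uv(1) add_closed[OF neg_closed[OF uv(1)] uv(2)]]
        add_neg_cancel[OF uv] by simp
    then have "add g v \<in> set_add add W H"
      using V(3) h t unfolding set_add_def by blast
    then obtain w k where w: "w \<in> W" "k \<in> H" "add g v = add w k"
      unfolding set_add_def by blast
    moreover have "w \<in> topspace T" using w(1) openin_subset[OF W(1)] by blast
    ultimately show ?thesis using g(5) coset_add_sub by auto
  qed
  then show thesis using that U(1) by blast
qed

text \<open>Translating by \<open>neg g\<close> and then by \<open>neg v\<close> moves the middle
  coset \<open>q\<close> to that of \<open>zero\<close>, where \<open>coset_entourage_zero\<close>
  applies. Undoing this represents \<open>r\<close> by \<open>add g (add v w)\<close>, with the same
  \<open>g\<close> that occurs for \<open>p\<close>.\<close>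

lemma coset_entourage_half:
  assumes U: "gyr_neighborhood U"
  obtains V where "gyr_neighborhood V" "coset_entourage V O coset_entourage V \<subseteq> coset_entourage U"
proof -
  have "openin T U" "zero \<in> U" using U by (auto simp: gyr_neighborhood_def)
  then obtain A where A: "openin T A" "zero \<in> A" "\<And>u v. u \<in> A \<Longrightarrow> v \<in> A \<Longrightarrow> add u v \<in> U"
    by (rule add_neighborhood) (rule that)
  obtain B where B: "gyr_neighborhood B" "\<And>q. (\<pi> zero, q) \<in> coset_entourage B \<Longrightarrow> q \<in> \<pi> ` A"
    by (rule coset_entourage_zero[OF A(1,2)]) (rule that)
  have "openin T (A \<inter> B)" "zero \<in> A \<inter> B"
    using A B(1) by (auto simp: gyr_neighborhood_def)
  then obtain V where V: "gyr_neighborhood V" "V \<subseteq> A \<inter> B"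
    by (rule gyr_neighborhood_exists)
  have A_top: "A \<subseteq> topspace T" using A(1) by (rule openin_subset)
  have "(p, r) \<in> coset_entourage U"
    if pq: "(p, q) \<in> coset_entourage V" and qr: "(q, r) \<in> coset_entourage V" for p q r
  proof -
    obtain g u v where g: "g \<in> topspace T" "u \<in> V" "v \<in> V" "p = \<pi> (add g u)" "q = \<pi> (add g v)"
      using pq unfolding coset_entourage_def by blast
    have uv: "u \<in> A" "v \<in> A" "v \<in> topspace T" using g(2,3) V(2) A_top by blast+
    have r: "r \<in> topspace X" using qr coset_entourage_subset[OF V(1)] by blast
    define s where "s = add (neg g) ` r"
    have s: "s \<in> topspace X"
      unfolding s_def by (rule translation_closed[OF neg_closed[OF g(1)] r])
    have "add (neg g) ` q = \<pi> v"
      using coset_translate[OF neg_closed[OF g(1)] add_closed[OF g(1) uv(3)]]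
        neg_add_cancel[OF g(1) uv(3)] g(5) by simp
    then have "(\<pi> v, s) \<in> coset_entourage V"
      using coset_entourage_translate[OF V(1) neg_closed[OF g(1)] qr] unfolding s_def by simp
    then have "(add (neg v) ` \<pi> v, add (neg v) ` s) \<in> coset_entourage V"
      by (rule coset_entourage_translate[OF V(1) neg_closed[OF uv(3)]])
    moreover have "add (neg v) ` \<pi> v = \<pi> zero"
      using coset_translate[OF neg_closed[OF uv(3)] uv(3)] neg_inverse[OF uv(3)] by simp
    moreover have "coset_entourage V \<subseteq> coset_entourage B"
      using V(2) by (intro coset_entourage_mono) blast
    ultimately have "add (neg v) ` s \<in> \<pi> ` A"
      using B(2) by auto
    then obtain w where w: "w \<in> A" "add (neg v) ` s = \<pi> w" by blast
    have w_top: "w \<in> topspace T" using w(1) A_top by blast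
    have "s = \<pi> (add v w)"
      using translation_cancel(2)[OF uv(3) s] coset_translate[OF uv(3) w_top] w(2) by simp
    then have "r = \<pi> (add g (add v w))"
      using translation_cancel(2)[OF g(1) r] coset_translate[OF g(1) add_closed[OF uv(3) w_top]]
      unfolding s_def by simp
    moreover have "add v w \<in> U" using A(3) uv(2) w(1) by blast
    \<comment> \<open>Since \<open>zero\<close> lies in \<open>A\<close>, the element
      \<open>u\<close> is itself a sum of two elements of \<open>A\<close>.\<close>
    moreover have "u \<in> U" using A(3)[OF uv(1) A(2)] zero_neutral uv(1) A_top by auto
    ultimately show ?thesis using g(1,4) unfolding coset_entourage_def by blast
  qed
  then show thesis using that[OF V(1)] by blast
qed

lemma openin_coset_entourage:
  assumes U: "gyr_neighborhood U"
  shows "openin X (coset_entourage U `` {p})"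
proof -
  let ?I = "{g \<in> topspace T. p \<in> \<pi> ` (add g ` U)}"
  have "coset_entourage U `` {p} = (\<Union>g\<in>?I. \<pi> ` (add g ` U))"
  proof (intro equalityI subsetI)
    fix q assume "q \<in> coset_entourage U `` {p}"
    then obtain g u v where "g \<in> topspace T" "u \<in> U" "v \<in> U" "p = \<pi> (add g u)" "q = \<pi> (add g v)"
      by (auto simp: coset_entourage_def)
    then show "q \<in> (\<Union>g\<in>?I. \<pi> ` (add g ` U))" by (intro UN_I[of g]) auto
  qed (auto simp: coset_entourage_def)
  moreover
  have "openin X (\<pi> ` (add g ` U))" if "g \<in> ?I" for g
    using that U by (intro openin_coset_image openin_add_image) (auto simp: gyr_neighborhood_def)
  then have "openin X (\<Union>g\<in>?I. \<pi> ` (add g ` U))"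
    by (intro openin_Union) (elim imageE, simp only:)
  ultimately show ?thesis by simp
qed

text \<open>Translation by \<open>neg a\<close> moves \<open>p\<close> to the coset of
  \<open>zero\<close>, and \<open>W\<close> is the open set of \<open>T\<close> obtained by moving
  \<open>\<W>\<close> along.\<close>

lemma coset_entourage_base:
  assumes \<W>: "openin X \<W>" "p \<in> \<W>"
  obtains U where "gyr_neighborhood U" "coset_entourage U `` {p} \<subseteq> \<W>"
proof -
  obtain a where a: "a \<in> topspace T" "p = \<pi> a"
    using openin_subset[OF \<W>(1)] \<W>(2) by (auto simp: topspace_coset_space)
  define W where "W = {b \<in> topspace T. \<pi> (add a b) \<in> \<W>}"
  have "openin T {b \<in> topspace T. (\<pi> \<circ> add a) b \<in> \<W>}"
    using openin_continuous_map_preimage[OF continuous_map_compose[OF continuous_add_left[OF a(1)]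
        quotient_imp_continuous_map[OF quotient_map_left_coset]] \<W>(1)] .
  then have W: "openin T W" by (simp add: W_def)
  moreover have "zero \<in> W" using zero_closed zero_neutral[OF a(1)] a(2) \<W>(2) by (simp add: W_def)
  ultimately obtain U where U: "gyr_neighborhood U"
    "\<And>q. (\<pi> zero, q) \<in> coset_entourage U \<Longrightarrow> q \<in> \<pi> ` W"
    by (rule coset_entourage_zero) (rule that)
  have "q \<in> \<W>" if q: "(p, q) \<in> coset_entourage U" for q
  proof -
    have q_top: "q \<in> topspace X" using q coset_entourage_subset[OF U(1)] by blast
    have "add (neg a) ` p = \<pi> zero"
      using coset_translate[OF neg_closed[OF a(1)] a(1)] neg_inverse[OF a(1)] a(2) by simp
    then have "(\<pi> zero, add (neg a) ` q) \<in> coset_entourage U"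
      using coset_entourage_translate[OF U(1) neg_closed[OF a(1)] q] by simp
    then obtain b where b: "b \<in> W" "add (neg a) ` q = \<pi> b" using U(2) by blast
    then have "b \<in> topspace T" by (simp add: W_def)
    then have "q = \<pi> (add a b)"
      using translation_cancel(2)[OF a(1) q_top] coset_translate[OF a(1)] b(2) by simp
    then show ?thesis using b(1) by (simp add: W_def)
  qed
  then show thesis using that[OF U(1)] by blast
qed

lemma homogeneous_uniformity_coset_space:
  "homogeneous_uniformity X {coset_entourage U |U. gyr_neighborhood U}"
proof (unfold_locales, goal_cases)
  case 1
  then show ?case by (rule t1_coset_space)
next
  case (2 E)
  then show ?case using coset_entourage_subset by auto
next
  case (3 E x)
  then obtain a U where a: "a \<in> topspace T" "x = \<pi> a" and U: "gyr_neighborhood U" "E = coset_entourage U"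
    by (auto simp: topspace_coset_space)
  have "\<pi> (add a zero) = x" "zero \<in> U"
    using a U zero_neutral by (simp_all add: gyr_neighborhood_def)
  then show ?case unfolding U(2) coset_entourage_def using a(1) by blast
next
  case (4 E x y)
  then show ?case unfolding coset_entourage_def by blast
next
  case (5 E)
  then obtain U where U: "gyr_neighborhood U" "E = coset_entourage U" by blast
  obtain V where "gyr_neighborhood V" "coset_entourage V O coset_entourage V \<subseteq> coset_entourage U"
    by (rule coset_entourage_half[OF U(1)])
  then show ?case using U(2) by blast
next
  case (6 E x)
  then show ?case using openin_coset_entourage by blast
next
  case (7 W x)
  obtain U where "gyr_neighborhood U" "coset_entourage U `` {x} \<subseteq> W"
    by (rule coset_entourage_base[OF 7])
  then show ?case by blast
next
  case (8 x y)
  then obtain a b where ab: "a \<in> topspace T" "x = \<pi> a" "b \<in> topspace T" "y = \<pi> b"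
    by (auto simp: topspace_coset_space)
  have aut: "entourage_automorphism X {coset_entourage U |U. gyr_neighborhood U} ((`) (add g))"
    if "g \<in> topspace T" for g
    using homeomorphic_translation[OF that] coset_entourage_translate_iff[OF _ that]
    unfolding entourage_automorphism_def by auto
  \<comment> \<open>Two translations are composed because \<open>add (add b (neg a)) a\<close> need
    not equal \<open>b\<close> in a gyrogroup.\<close>
  have "entourage_automorphism X {coset_entourage U |U. gyr_neighborhood U}
      ((`) (add b) \<circ> (`) (add (neg a)))"
    using aut[OF neg_closed[OF ab(1)]] aut[OF ab(3)] by (rule entourage_automorphism_comp)
  moreover have "((`) (add b) \<circ> (`) (add (neg a))) x = y"
    using coset_translate[OF neg_closed[OF ab(1)] ab(1)] neg_inverse[OF ab(1)]
      coset_translate[OF ab(3) zero_closed] zero_neutral[OF ab(3)] ab(2,4) by simp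
  ultimately show ?case by blast
qed

end

theorem corollary3p18:
  fixes T :: "'a topology"
    and add :: "'a \<Rightarrow> 'a \<Rightarrow> 'a"
    and zero :: 'a
    and neg :: "'a \<Rightarrow> 'a"
    and gyr :: "'a \<Rightarrow> 'a \<Rightarrow> 'a \<Rightarrow> 'a"
    and H :: "'a set"
  assumes "strongly_topological_gyrogroup T add zero neg gyr"
    and "strong_subgyrogroup (topspace T) add gyr H"
    and "closedin T H"
    and "inner_neutral T add zero H"
  shows "(first_countable (coset_space T add H) \<longleftrightarrow> bisequential (coset_space T add H)) \<and>
         (first_countable (coset_space T add H) \<longleftrightarrow> weakly_first_countable (coset_space T add H)) \<and>
         (first_countable (coset_space T add H) \<longleftrightarrow>
            csf_countable (coset_space T add H) \<and> sequential_space (coset_space T add H) \<and>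
            alpha7_space (coset_space T add H))"
proof -
  interpret inner_neutral_coset_space T add zero neg gyr H
    using assms by (simp add: inner_neutral_coset_space_def inner_neutral_coset_space_axioms_def)
  interpret homogeneous_uniformity "coset_space T add H" "{coset_entourage U |U. gyr_neighborhood U}"
    by (rule homogeneous_uniformity_coset_space)
  show ?thesis
    by (intro conjI first_countable_iff_bisequential first_countable_iff_weakly_first_countable
        first_countable_iff_csf_sequential_alpha7)
qed

end
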